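(* Let $k$ be a field of characteristic $\neq 2$ containing a primitive fourth root of unity $\sqrt{-1}$. The Ueno–Campana threefold $X$ over $k$ is unirational over $k$: there exists a dominant rational map $\mathbb{P}^3 \dashrightarrow X$ defined over $k$.
   Context: Let $C\subset\mathbb{P}^2$ be the elliptic curve $y^2z = x(x^2-z^2)$ (homogeneous coordinates $[x:y:z]$), with the order-4 automorphism $g$ given by $[x:y:z]\mapsto[-x:\sqrt{-1}\,y:z]$. Let $C_1,C_2,C_3$ be three copies of $(C,g)$, $Z=C_1\times C_2\times C_3$, and let $g$ also denote the diagonal automorphism $(g,g,g)$ of $Z$, which has order 4. The quotient $Y=Z/\langle g\rangle$ has $8$ singular points of type $\frac14(1,1,1)$ and $28$ singular points of type $\frac12(1,1,1)$. The Ueno–Campana threefold $X$ is the blow-up of $Y$ at the maximal ideals of these singular points; it is a smooth projective threefold over $k$, birational to $Z/\langle g\rangle$, and its function field is $k(X)=k(Z)^g$. *)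

theory Defs
  imports "HOL-Computational_Algebra.Polynomial"
begin

definition is_subfield :: "'f::field set \<Rightarrow> bool" where
  "is_subfield S \<longleftrightarrow> 0 \<in> S \<and> 1 \<in> S \<and>
     (\<forall>a\<in>S. \<forall>b\<in>S. a + b \<in> S \<and> a * b \<in> S) \<and>
     (\<forall>a\<in>S. - a \<in> S \<and> inverse a \<in> S)"

definition gen_field :: "'f::field set \<Rightarrow> 'f set \<Rightarrow> 'f set" where
  "gen_field K S = \<Inter> {F. is_subfield F \<and> K \<subseteq> F \<and> S \<subseteq> F}"

definition K_hom_on :: "'f::field set \<Rightarrow> 'f set \<Rightarrow> ('f \<Rightarrow> 'f) \<Rightarrow> bool" where
  "K_hom_on K S \<sigma> \<longleftrightarrow> \<sigma> 1 = 1 \<and>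
     (\<forall>a\<in>S. \<forall>b\<in>S. \<sigma> (a + b) = \<sigma> a + \<sigma> b \<and> \<sigma> (a * b) = \<sigma> a * \<sigma> b) \<and>
     (\<forall>c\<in>K. \<sigma> c = c)"

definition eval3 :: "'f::comm_ring_1 poly poly poly \<Rightarrow> 'f \<Rightarrow> 'f \<Rightarrow> 'f \<Rightarrow> 'f" where
  "eval3 p a b c = poly (poly (poly p [:[:a:]:]) [:b:]) c"

definition coeffs_in3 :: "'f::comm_ring_1 set \<Rightarrow> 'f poly poly poly \<Rightarrow> bool" where
  "coeffs_in3 K p \<longleftrightarrow> (\<forall>i j l. coeff (coeff (coeff p i) j) l \<in> K)"

definition alg_indep3 :: "'f::field set \<Rightarrow> 'f \<Rightarrow> 'f \<Rightarrow> 'f \<Rightarrow> bool" where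
  "alg_indep3 K a b c \<longleftrightarrow> (\<forall>p. coeffs_in3 K p \<and> eval3 p a b c = 0 \<longrightarrow> p = 0)"

text \<open>Function field k(Z) of Z = C x C x C, realised as K(x1,y1,x2,y2,x3,y3) with
  x1,x2,x3 algebraically independent over K and yi^2 = xi^3 - xi (affine chart z = 1 of
  y^2 z = x(x^2 - z^2)).\<close>
definition fun_field_Z :: "'f::field set \<Rightarrow> 'f \<Rightarrow> 'f \<Rightarrow> 'f \<Rightarrow> 'f \<Rightarrow> 'f \<Rightarrow> 'f \<Rightarrow> 'f set" where
  "fun_field_Z K x1 y1 x2 y2 x3 y3 = gen_field K {x1, y1, x2, y2, x3, y3}"

text \<open>k(X) = k(Z)^g, where g acts on functions by x_j -> -x_j, y_j -> i y_j.
  An element is invariant if it is fixed by every K-homomorphism on k(Z) that acts on the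
  generators like g (there is exactly one such map on k(Z), namely g).\<close>
definition fun_field_X :: "'f::field set \<Rightarrow> 'f \<Rightarrow> 'f \<Rightarrow> 'f \<Rightarrow> 'f \<Rightarrow> 'f \<Rightarrow> 'f \<Rightarrow> 'f \<Rightarrow> 'f set" where
  "fun_field_X K ii x1 y1 x2 y2 x3 y3 =
     {f \<in> fun_field_Z K x1 y1 x2 y2 x3 y3.
        \<forall>\<sigma>. K_hom_on K (fun_field_Z K x1 y1 x2 y2 x3 y3) \<sigma> \<and>
            \<sigma> x1 = - x1 \<and> \<sigma> x2 = - x2 \<and> \<sigma> x3 = - x3 \<and>
            \<sigma> y1 = ii * y1 \<and> \<sigma> y2 = ii * y2 \<and> \<sigma> y3 = ii * y3 \<longrightarrow> \<sigma> f = f}"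

end

theory Submission
  imports Defs
begin

text \<open>Put \<open>a = x\<^sub>2/x\<^sub>3\<close>, \<open>b = x\<^sub>1/x\<^sub>3\<close>, \<open>u = y\<^sub>2/y\<^sub>3\<close>, \<open>v = y\<^sub>1/y\<^sub>3\<close> and
  \<open>w = x\<^sub>3\<^sup>2/(1 - x\<^sub>3\<^sup>2)\<close>. These are \<open>g\<close>-invariant and generate \<open>k(X)\<close>; the elements
  \<open>a, b, w\<close> are algebraically independent, and \<open>u\<^sup>2 = a (1 + (1 - a\<^sup>2) w)\<close>,
  \<open>v\<^sup>2 = b (1 + (1 - b\<^sup>2) w)\<close>. Eliminating \<open>w\<close> exhibits \<open>X\<close> as a conic bundle over the
  \<open>(a, b)\<close>-plane. At \<open>w = 0\<close> the conic has the point \<open>u = \<surd>a\<close>, \<open>v = \<surd>b\<close>, so after the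
  base change \<open>a = t\<^sub>3\<^sup>2\<close>, \<open>b = t\<^sub>2\<^sup>2\<close> it becomes rational, with parameter \<open>t\<^sub>1\<close>.\<close>

section \<open>Subfields and generators\<close>

text \<open>Rings are carrier sets, so that one notion covers subfields, sets of polynomials over
  them and images of evaluation maps in the ambient field.\<close>

definition is_subring :: "'a::comm_ring_1 set \<Rightarrow> bool" where
  "is_subring R \<longleftrightarrow> 0 \<in> R \<and> 1 \<in> R \<and>
     (\<forall>a\<in>R. \<forall>b\<in>R. a + b \<in> R \<and> a * b \<in> R) \<and> (\<forall>a\<in>R. - a \<in> R)"

lemma is_subring_sum:
  assumes "is_subring R" "\<And>i. i \<in> I \<Longrightarrow> f i \<in> R"
  shows "sum f I \<in> R"
  using assms by (induction I rule: infinite_finite_induct) (auto simp: is_subring_def)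

lemma is_subfield_imp_is_subring: "is_subfield F \<Longrightarrow> is_subring F"
  by (auto simp: is_subfield_def is_subring_def)

lemma is_subring_image:
  assumes "is_subring R" "h 0 = 0" "h 1 = 1"
    and "\<And>x y. h (x + y) = h x + h y" "\<And>x y. h (x * y) = h x * h y"
  shows "is_subring (h ` R)"
proof -
  have "h (- x) = - h x" for x
    using assms(4)[of x "- x"] assms(2) by (simp add: minus_unique)
  then have "- h x \<in> h ` R" if "x \<in> R" for x
    using assms(1) that by (metis imageI is_subring_def)
  moreover have "h x + h y \<in> h ` R" "h x * h y \<in> h ` R" if "x \<in> R" "y \<in> R" for x y
    using assms(1) that unfolding assms(4,5)[symmetric] by (auto simp: is_subring_def)
  moreover have "0 \<in> h ` R" "1 \<in> h ` R"
    using assms(1-3) unfolding is_subring_def by (metis imageI)+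
  ultimately show ?thesis
    unfolding is_subring_def by auto
qed

context
  fixes F :: "'f::field set"
  assumes F: "is_subfield F"
begin

lemma subfield_0: "0 \<in> F" and subfield_1: "1 \<in> F"
  using F by (auto simp: is_subfield_def)

lemma subfield_add: "a \<in> F \<Longrightarrow> b \<in> F \<Longrightarrow> a + b \<in> F"
  and subfield_mult: "a \<in> F \<Longrightarrow> b \<in> F \<Longrightarrow> a * b \<in> F"
  and subfield_uminus: "a \<in> F \<Longrightarrow> - a \<in> F"
  and subfield_inverse: "a \<in> F \<Longrightarrow> inverse a \<in> F"
  using F by (auto simp: is_subfield_def)

lemma subfield_diff: "a \<in> F \<Longrightarrow> b \<in> F \<Longrightarrow> a - b \<in> F"
  using subfield_add[of a "- b"] subfield_uminus[of b] by simp

lemma subfield_divide: "a \<in> F \<Longrightarrow> b \<in> F \<Longrightarrow> a / b \<in> F"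
  unfolding divide_inverse by (intro subfield_mult subfield_inverse)

lemma subfield_power: "a \<in> F \<Longrightarrow> a ^ n \<in> F"
  by (induction n) (auto intro: subfield_1 subfield_mult)

lemma subfield_numeral: "numeral n \<in> F"
proof (induction n)
  case One
  then show ?case using subfield_1 by simp
next
  case (Bit0 n)
  then show ?case using subfield_add[of "numeral n" "numeral n"] by (simp add: numeral_Bit0)
next
  case (Bit1 n)
  then show ?case
    using subfield_add[OF subfield_add[of "numeral n" "numeral n"] subfield_1]
    by (simp add: numeral_Bit1)
qed

lemmas subfield_intros = subfield_0 subfield_1 subfield_add subfield_mult subfield_uminus
  subfield_inverse subfield_diff subfield_divide subfield_power subfield_numeral

end

lemma is_subfield_gen_field: "is_subfield (gen_field K S)"
  unfolding gen_field_def is_subfield_def by auto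

lemma base_subset_gen_field: "K \<subseteq> gen_field K S"
  and gens_subset_gen_field: "S \<subseteq> gen_field K S"
  unfolding gen_field_def by auto

lemma mem_gen_field: "z \<in> S \<Longrightarrow> z \<in> gen_field K S"
  using gens_subset_gen_field by blast

lemma gen_field_least: "is_subfield F \<Longrightarrow> K \<subseteq> F \<Longrightarrow> S \<subseteq> F \<Longrightarrow> gen_field K S \<subseteq> F"
  unfolding gen_field_def by auto

lemma gen_field_mono: "S \<subseteq> T \<Longrightarrow> gen_field K S \<subseteq> gen_field K T"
  unfolding gen_field_def by blast

text \<open>Lets generators be adjoined one at a time: the later towers are built from simple
  extensions and renamed by this equation.\<close>

lemma gen_field_gen_field: "gen_field (gen_field K S) T = gen_field K (S \<union> T)"
proof (rule equalityI; rule gen_field_least[OF is_subfield_gen_field])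
  show "gen_field K S \<subseteq> gen_field K (S \<union> T)"
    by (rule gen_field_mono[OF Un_upper1])
  show "T \<subseteq> gen_field K (S \<union> T)"
    using gens_subset_gen_field[of "S \<union> T" K] by simp
  show "K \<subseteq> gen_field (gen_field K S) T"
    by (rule order.trans[OF base_subset_gen_field[of K S] base_subset_gen_field])
  show "S \<union> T \<subseteq> gen_field (gen_field K S) T"
    using order.trans[OF gens_subset_gen_field[of S K] base_subset_gen_field]
      gens_subset_gen_field[of T "gen_field K S"] by (rule Un_least)
qed

section \<open>Fraction fields inside the ambient field\<close>

definition fractions :: "'f::field set \<Rightarrow> 'f set" where
  "fractions R = {n / d | n d. n \<in> R \<and> d \<in> R \<and> d \<noteq> 0}"

lemma is_subfield_fractions:
  assumes R: "is_subring R"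
  shows "is_subfield (fractions R)"
proof -
  have neg: "- a \<in> R" if "a \<in> R" for a
    using R that by (auto simp: is_subring_def)
  have add: "a + b \<in> R" and mult: "a * b \<in> R" if "a \<in> R" "b \<in> R" for a b
    using R that by (auto simp: is_subring_def)
  have zo: "0 \<in> R" "1 \<in> R"
    using R by (auto simp: is_subring_def)
  have I: "n / d \<in> fractions R" if "n \<in> R" "d \<in> R" "d \<noteq> 0" for n d
    using that by (auto simp: fractions_def)
  show ?thesis
    unfolding is_subfield_def
  proof (intro conjI ballI)
    show "0 \<in> fractions R" using I[of 0 1] zo by simp
    show "1 \<in> fractions R" using I[of 1 1] zo by simp
  next
    fix a b assume "a \<in> fractions R" "b \<in> fractions R"
    then obtain n d n' d' where nd: "n \<in> R" "d \<in> R" "d \<noteq> 0" "a = n / d"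
      "n' \<in> R" "d' \<in> R" "d' \<noteq> 0" "b = n' / d'"
      unfolding fractions_def by blast
    have "a + b = (n * d' + n' * d) / (d * d')"
      using nd by (simp add: add_frac_eq)
    then show "a + b \<in> fractions R"
      using I[of "n * d' + n' * d" "d * d'"] nd add mult by simp
    show "a * b \<in> fractions R"
      using I[of "n * n'" "d * d'"] nd mult by simp
  next
    fix a assume "a \<in> fractions R"
    then obtain n d where nd: "n \<in> R" "d \<in> R" "d \<noteq> 0" "a = n / d"
      unfolding fractions_def by blast
    show "- a \<in> fractions R"
      using I[of "- n" d] nd neg by simp
    show "inverse a \<in> fractions R"
      using I[of d n] I[of 0 1] nd zo by (cases "n = 0") auto
  qed
qed

lemma subset_fractions:
  assumes "is_subring R"
  shows "R \<subseteq> fractions R"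
proof
  fix x assume "x \<in> R"
  then have "x = x / 1 \<and> x \<in> R \<and> 1 \<in> R \<and> (1::'a) \<noteq> 0"
    using assms by (simp add: is_subring_def)
  then show "x \<in> fractions R"
    unfolding fractions_def by blast
qed

text \<open>The quotients of elements of \<open>R\<close> already form a subfield. This replaces the
  intersection defining \<open>gen_field\<close> by an explicit shape of its elements.\<close>

lemma gen_field_subset_fractions:
  assumes R: "is_subring R" and "K \<subseteq> R" "S \<subseteq> R"
  shows "gen_field K S \<subseteq> fractions R"
proof (rule gen_field_least[OF is_subfield_fractions[OF R]])
  show "K \<subseteq> fractions R" "S \<subseteq> fractions R"
    using assms(2,3) subset_fractions[OF R] by simp_all
qed

section \<open>Polynomials with coefficients in a given set\<close>

definition coeffs_in :: "'a::zero set \<Rightarrow> 'a poly \<Rightarrow> bool" where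
  "coeffs_in R p \<longleftrightarrow> (\<forall>i. coeff p i \<in> R)"

lemma coeffs_in_pCons [simp]: "coeffs_in R (pCons a p) \<longleftrightarrow> a \<in> R \<and> coeffs_in R p"
  unfolding coeffs_in_def by (metis coeff_pCons_0 coeff_pCons_Suc not0_implies_Suc)

lemma coeffs_in_0 [simp]: "coeffs_in R 0 \<longleftrightarrow> 0 \<in> R"
  by (simp add: coeffs_in_def)

lemma coeffs_in_mono: "coeffs_in R p \<Longrightarrow> R \<subseteq> S \<Longrightarrow> coeffs_in S p"
  unfolding coeffs_in_def by blast

lemma is_subring_polys: "is_subring R \<Longrightarrow> is_subring {p. coeffs_in R p}"
  unfolding is_subring_def[of "{p. coeffs_in R p}"]
  by (auto simp: coeffs_in_def coeff_mult intro!: is_subring_sum)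
    (auto simp: is_subring_def coeff_1)

lemma coeffs_in_add: "is_subring R \<Longrightarrow> coeffs_in R p \<Longrightarrow> coeffs_in R q \<Longrightarrow> coeffs_in R (p + q)"
  and coeffs_in_mult: "is_subring R \<Longrightarrow> coeffs_in R p \<Longrightarrow> coeffs_in R q \<Longrightarrow> coeffs_in R (p * q)"
  and coeffs_in_uminus: "is_subring R \<Longrightarrow> coeffs_in R p \<Longrightarrow> coeffs_in R (- p)"
  using is_subring_polys[of R] by (auto simp: is_subring_def)

lemma coeffs_in_diff: "is_subring R \<Longrightarrow> coeffs_in R p \<Longrightarrow> coeffs_in R q \<Longrightarrow> coeffs_in R (p - q)"
  using coeffs_in_add[of R p "- q"] coeffs_in_uminus[of R q] by simp

lemma coeffs_in_power: "is_subring R \<Longrightarrow> coeffs_in R p \<Longrightarrow> coeffs_in R (p ^ n)"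
proof (induction n)
  case 0
  then show ?case by (auto simp: is_subring_def one_pCons)
next
  case (Suc n)
  then show ?case by (simp add: coeffs_in_mult)
qed

lemma poly_in_subring: "is_subring R \<Longrightarrow> coeffs_in R p \<Longrightarrow> x \<in> R \<Longrightarrow> poly p x \<in> R"
proof (induction p)
  case 0
  then show ?case by (simp add: is_subring_def)
next
  case (pCons a p)
  then show ?case by (simp add: is_subring_def)
qed

lemma hom_poly:
  fixes h :: "'a::comm_ring_1 \<Rightarrow> 'b::comm_ring_1"
  assumes "h 0 = 0" "\<And>x y. h (x + y) = h x + h y" "\<And>x y. h (x * y) = h x * h y"
  shows "h (poly p k) = poly (map_poly h p) (h k)"
  by (induction p) (simp_all add: assms map_poly_pCons)

section \<open>Transcendental elements\<close>

definition transc :: "'f::field set \<Rightarrow> 'f \<Rightarrow> bool" where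
  "transc R x \<longleftrightarrow> (\<forall>p. coeffs_in R p \<longrightarrow> poly p x = 0 \<longrightarrow> p = 0)"

lemma transcD: "transc R x \<Longrightarrow> coeffs_in R p \<Longrightarrow> poly p x = 0 \<Longrightarrow> p = 0"
  by (auto simp: transc_def)

lemma transc_mono: "transc S x \<Longrightarrow> R \<subseteq> S \<Longrightarrow> transc R x"
  unfolding transc_def using coeffs_in_mono by blast

lemma transc_eqD:
  assumes "transc F x" "is_subring F" "coeffs_in F p" "coeffs_in F q" "poly p x = poly q x"
  shows "p = q"
  using transcD[OF assms(1) coeffs_in_diff[OF assms(2-4)]] assms(5) by simp

text \<open>A relation for \<open>h k\<close> over the image of \<open>A\<close> lifts
  coefficientwise to a polynomial over \<open>A\<close>, to which \<open>indep\<close> applies. With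
  \<open>h\<close> an evaluation map, independence of several variables becomes transcendence of one
  element over a ring of values.\<close>

lemma transc_image:
  fixes h :: "'a::comm_ring_1 \<Rightarrow> 'f::field"
  assumes hom: "h 0 = 0" "\<And>x y. h (x + y) = h x + h y" "\<And>x y. h (x * y) = h x * h y"
    and "0 \<in> A"
    and indep: "\<And>q. coeffs_in A q \<Longrightarrow> h (poly q k) = 0 \<Longrightarrow> q = 0"
  shows "transc (h ` A) (h k)"
  unfolding transc_def
proof (intro allI impI)
  fix p assume p: "coeffs_in (h ` A) p" and 0: "poly p (h k) = 0"
  \<comment> \<open>A chosen preimage under \<open>h\<close>, forced to send 0 to 0 so that
    \<open>map_poly g\<close> acts on every coefficient.\<close>
  define g where "g z = (if z = 0 then 0 else SOME a. a \<in> A \<and> h a = z)" for z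
  have g: "g z \<in> A \<and> h (g z) = z" if "z \<in> h ` A" for z
  proof (cases "z = 0")
    case True
    then show ?thesis using assms(1,4) by (simp add: g_def)
  next
    case False
    have "\<exists>a. a \<in> A \<and> h a = z" using that by blast
    from someI_ex[OF this] show ?thesis using False by (simp add: g_def)
  qed
  define q where "q = map_poly g p"
  have cq: "coeff q i = g (coeff p i)" for i
    by (simp add: q_def coeff_map_poly g_def)
  have "coeffs_in A q"
    using p g by (simp add: coeffs_in_def cq)
  moreover have "map_poly h q = p"
    using p g by (intro poly_eqI) (simp add: coeff_map_poly hom cq coeffs_in_def)
  ultimately have "q = 0"
    using indep[of q] 0 by (simp add: hom_poly[of h, OF hom])
  then show "p = 0"
    using \<open>map_poly h q = p\<close> by simp
qed

text \<open>Multiplying a relation by a common denominator of its coefficients gives a relation over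
  \<open>R\<close>.\<close>

lemma transc_fractions:
  assumes R: "is_subring R" and x: "transc R x"
  shows "transc (fractions R) x"
  unfolding transc_def
proof (intro allI impI)
  fix p assume p: "coeffs_in (fractions R) p" "poly p x = 0"
  have "\<exists>e\<in>R. e \<noteq> 0 \<and> coeffs_in R (smult e p)"
    using p(1)
  proof (induction p)
    case 0
    then show ?case using R by (auto simp: is_subring_def intro!: bexI[of _ 1])
  next
    case (pCons a p)
    then obtain e where e: "e \<in> R" "e \<noteq> 0" "coeffs_in R (smult e p)"
      by auto
    obtain n d where nd: "n \<in> R" "d \<in> R" "d \<noteq> 0" "a = n / d"
      using pCons.prems unfolding coeffs_in_pCons fractions_def by blast
    have "smult (d * e) (pCons a p) = pCons (n * e) (smult d (smult e p))"
      using nd by simp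
    moreover have "coeffs_in R (smult d q)" if "coeffs_in R q" for q
      using that R nd(2) by (simp add: coeffs_in_def is_subring_def)
    ultimately have "coeffs_in R (smult (d * e) (pCons a p))"
      using e nd R by (simp add: is_subring_def del: smult_smult)
    then show ?case
      using e nd R by (intro bexI[of _ "d * e"]) (auto simp: is_subring_def)
  qed
  then obtain e where "e \<in> R" "e \<noteq> 0" "coeffs_in R (smult e p)"
    by blast
  then show "p = 0"
    using transcD[OF x, of "smult e p"] p(2) by simp
qed

lemma is_subring_poly_image:
  fixes x :: "'f::field"
  shows "is_subring F \<Longrightarrow> is_subring ((\<lambda>p. poly p x) ` {p. coeffs_in F p})"
  by (intro is_subring_image is_subring_polys) auto

lemma gen_field_subset_fractions_poly:
  assumes F: "is_subring F"
  shows "gen_field F {x} \<subseteq> fractions ((\<lambda>p. poly p x) ` {p. coeffs_in F p})"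
proof (rule gen_field_subset_fractions[OF is_subring_poly_image[OF F]])
  have F01: "0 \<in> F" "1 \<in> F"
    using F by (auto simp: is_subring_def)
  show "F \<subseteq> (\<lambda>p. poly p x) ` {p. coeffs_in F p}"
  proof
    fix a assume "a \<in> F"
    then show "a \<in> (\<lambda>p. poly p x) ` {p. coeffs_in F p}"
      using F01 by (intro image_eqI[of _ _ "[:a:]"]) auto
  qed
  show "{x} \<subseteq> (\<lambda>p. poly p x) ` {p. coeffs_in F p}"
    using F01 by (auto intro!: image_eqI[of _ _ "[:0, 1:]"])
qed

lemma gen_field_singletonE:
  assumes "is_subring F" "z \<in> gen_field F {x}"
  obtains p q where "coeffs_in F p" "coeffs_in F q" "poly q x \<noteq> 0" "z = poly p x / poly q x"
  using gen_field_subset_fractions_poly[OF assms(1)] assms(2) unfolding fractions_def by blast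

text \<open>\<open>eval3\<close> puts \<open>a\<close> in for the outermost variable and
  \<open>c\<close> for the innermost, so the tower is climbed from \<open>c\<close>. In the upper
  levels \<open>transc_image\<close> evaluates the inner variables, and passing to fractions
  replaces rings of values by fields.\<close>

lemma alg_indep3_tower:
  assumes K: "is_subfield K" and indep: "alg_indep3 K a b c"
  shows "transc K c" "transc (gen_field K {c}) b" "transc (gen_field K {c, b}) a"
proof -
  note Kr = is_subfield_imp_is_subring[OF K]
  have K0: "0 \<in> K" and K1: "1 \<in> K"
    using K by (auto simp: is_subfield_def)
  have indep': "p = 0"
    if "coeffs_in {q. coeffs_in {r. coeffs_in K r} q} p" "poly (poly (poly p [:[:a:]:]) [:b:]) c = 0" for p
    using indep that unfolding alg_indep3_def coeffs_in3_def eval3_def coeffs_in_def by blast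
  show "transc K c"
    unfolding transc_def using indep'[of "[:[:_:]:]"] K0 by simp
  have "transc ((\<lambda>q. poly q c) ` {q. coeffs_in K q}) (poly [:b:] c)"
    by (rule transc_image) (use indep'[of "[:_:]"] K0 in auto)
  then have "transc (fractions ((\<lambda>q. poly q c) ` {q. coeffs_in K q})) b"
    using transc_fractions[OF is_subring_poly_image[OF Kr]] by simp
  then show "transc (gen_field K {c}) b"
    using gen_field_subset_fractions_poly[OF Kr] by (rule transc_mono)
  let ?h = "\<lambda>q. poly (poly q [:b:]) c" and ?A = "{q. coeffs_in {r. coeffs_in K r} q}"
  have "transc (?h ` ?A) (?h [:[:a:]:])"
    by (rule transc_image) (use indep' K0 in auto)
  moreover have sub: "is_subring (?h ` ?A)"
    by (intro is_subring_image is_subring_polys Kr) auto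
  ultimately have "transc (fractions (?h ` ?A)) a"
    using transc_fractions by simp
  moreover have "gen_field K {c, b} \<subseteq> fractions (?h ` ?A)"
  proof (rule gen_field_subset_fractions[OF sub])
    have "z \<in> ?h ` ?A" if "z \<in> K" for z
      using that K0 by (intro image_eqI[of _ _ "[:[:z:]:]"]) auto
    then show "K \<subseteq> ?h ` ?A" by blast
    have "c \<in> ?h ` ?A"
      using K0 K1 by (intro image_eqI[of _ _ "[:[:0, 1:]:]"]) auto
    moreover have "b \<in> ?h ` ?A"
      using K0 K1 by (intro image_eqI[of _ _ "[:0, 1:]"]) (auto simp: one_pCons)
    ultimately show "{c, b} \<subseteq> ?h ` ?A" by blast
  qed
  ultimately show "transc (gen_field K {c, b}) a"
    by (rule transc_mono)
qed

text \<open>A relation for \<open>x\<close> over F[y] is read as a polynomial in \<open>y\<close>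
  over F(x). Its coefficients vanish because \<open>y\<close> is transcendental there; they are
  polynomials in \<open>x\<close> over \<open>F\<close>, so they vanish identically.\<close>

lemma transc_exchange:
  assumes F: "is_subfield F" and x: "transc F x" and y: "transc (gen_field F {x}) y"
  shows "transc (gen_field F {y}) x"
proof -
  note Fr = is_subfield_imp_is_subring[OF F]
  let ?G = "gen_field F {x}"
  have F0: "0 \<in> F" using F by (auto simp: is_subfield_def)
  have "transc ((\<lambda>q. poly q y) ` {q. coeffs_in F q}) (poly [:x:] y)"
  proof (rule transc_image)
    fix q assume q: "coeffs_in {q. coeffs_in F q} q" and 0: "poly (poly q [:x:]) y = 0"
    have G: "is_subring ?G"
      by (intro is_subfield_imp_is_subring is_subfield_gen_field)
    have "poly q [:x:] \<in> {p. coeffs_in ?G p}"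
    proof (rule poly_in_subring[OF is_subring_polys[OF G]])
      show "coeffs_in {p. coeffs_in ?G p} q"
        using q coeffs_in_mono[OF _ base_subset_gen_field]
        by (auto simp: coeffs_in_def[of "Collect _"])
      have "0 \<in> ?G" "x \<in> ?G"
        using subfield_0[OF is_subfield_gen_field] gens_subset_gen_field by blast+
      then show "[:x:] \<in> {p. coeffs_in ?G p}" by simp
    qed
    then have q0: "poly q [:x:] = 0"
      using transcD[OF y _ 0] by simp
    \<comment> \<open>Interchange of the variables: this polynomial collects the \<open>j\<close>-th
      inner coefficients, and its value at \<open>x\<close> is the coefficient of y^j.\<close>
    have "map_poly (\<lambda>r. coeff r j) q = 0" for j
    proof (rule transcD[OF x])
      show "coeffs_in F (map_poly (\<lambda>r. coeff r j) q)"
        using q by (simp add: coeffs_in_def coeff_map_poly)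
      have "poly (map_poly (\<lambda>r. coeff r j) q) x = coeff (poly q [:x:]) j"
        by (induction q) (simp_all add: map_poly_pCons)
      then show "poly (map_poly (\<lambda>r. coeff r j) q) x = 0"
        by (simp add: q0)
    qed
    then have "coeff (coeff q i) j = 0" for i j
      using coeff_map_poly[of "\<lambda>r. coeff r j" q i] by simp
    then show "q = 0"
      by (intro poly_eqI) (simp add: poly_eqI)
  qed (use F0 in auto)
  then have "transc (fractions ((\<lambda>q. poly q y) ` {q. coeffs_in F q})) x"
    using transc_fractions[OF is_subring_poly_image[OF Fr]] by simp
  then show ?thesis
    using gen_field_subset_fractions_poly[OF Fr] by (rule transc_mono)
qed

text \<open>The hypotheses say that the substitution sends the place \<open>x = 0\<close> to \<open>w = 0\<close>, so the constant
  term of an algebraic relation for \<open>w\<close> must vanish.\<close>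

lemma transc_rational:
  assumes F: "is_subring F" and x: "transc F x"
    and N: "coeffs_in F n" "poly n 0 = 0" "n \<noteq> 0" and D: "coeffs_in F d" "poly d 0 \<noteq> 0"
  shows "transc F (poly n x / poly d x)"
proof -
  define w where "w = poly n x / poly d x"
  have "d \<noteq> 0" using D(2) by auto
  then have dx: "poly d x \<noteq> 0" and nx: "poly n x \<noteq> 0"
    using transcD[OF x] N D by auto
  \<comment> \<open>\<open>h\<close> is \<open>p\<close> evaluated at n/d with the denominators
    cleared. Its value at 0 is recorded too, so that a relation can be compared at the place x =
    0.\<close>
  have "\<exists>h k. coeffs_in F h \<and> poly h x = poly d x ^ k * poly p w \<and> poly h 0 = poly d 0 ^ k * poly p 0"
    if "coeffs_in F p" for p
    using that
  proof (induction p)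
    case 0
    then show ?case by (intro exI[of _ 0]) (simp add: is_subring_def)
  next
    case (pCons a p)
    then obtain h k where h: "coeffs_in F h" "poly h x = poly d x ^ k * poly p w"
      by auto
    have "coeffs_in F [:a:]"
      using pCons.prems F by (simp add: is_subring_def)
    then have "coeffs_in F (d ^ Suc k * [:a:] + n * h)"
      by (intro coeffs_in_add coeffs_in_mult coeffs_in_power F D N h)
    moreover have "poly (d ^ Suc k * [:a:] + n * h) x = poly d x ^ Suc k * poly (pCons a p) w"
      using dx by (simp add: h w_def field_simps)
    moreover have "poly (d ^ Suc k * [:a:] + n * h) 0 = poly d 0 ^ Suc k * poly (pCons a p) 0"
      by (simp add: N)
    ultimately show ?case by blast
  qed
  then have const: "poly p 0 = 0" if "coeffs_in F p" "poly p w = 0" for p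
    using transcD[OF x] that D(2) by (metis mult_eq_0_iff poly_0 power_not_zero)
  \<comment> \<open>Once its constant term is zero, \<open>p\<close> is divisible by its variable;
    as \<open>w\<close> is nonzero, the quotient is again a relation, of smaller degree.\<close>
  have "p = 0" if "coeffs_in F p" "poly p w = 0" for p
    using that
  proof (induction p)
    case (pCons a p)
    then have "a = 0"
      using const[of "pCons a p"] by simp
    then have "poly p w = 0"
      using pCons.prems dx nx by (simp add: w_def)
    then show ?case
      using pCons \<open>a = 0\<close> by simp
  qed simp
  then show ?thesis
    by (simp add: transc_def w_def)
qed

section \<open>Square roots\<close>

text \<open>The elements \<open>\<alpha> + \<beta> * r\<close> already form a field, inverses being
  found with the conjugate \<open>\<alpha> - \<beta> * r\<close>. If \<open>r\<close> lies in
  \<open>F\<close>, nothing is adjoined.\<close>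

lemma gen_field_sqrtE:
  assumes F: "is_subfield F" and r: "r\<^sup>2 \<in> F" and z: "z \<in> gen_field F {r}"
  obtains \<alpha> \<beta> where "\<alpha> \<in> F" "\<beta> \<in> F" "z = \<alpha> + \<beta> * r"
proof (cases "r \<in> F")
  case True
  then have "gen_field F {r} \<subseteq> F"
    using F by (intro gen_field_least) auto
  then show ?thesis
    using that[of z 0] z subfield_0[OF F] by auto
next
  case False
  note F_intros = subfield_intros[OF F]
  define E where "E = {\<alpha> + \<beta> * r | \<alpha> \<beta>. \<alpha> \<in> F \<and> \<beta> \<in> F}"
  have EI: "z \<in> E" if "z = \<alpha> + \<beta> * r" "\<alpha> \<in> F" "\<beta> \<in> F" for z \<alpha> \<beta>
    using that by (auto simp: E_def)
  have FE: "\<alpha> \<in> E" if "\<alpha> \<in> F" for \<alpha>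
    by (rule EI[of _ \<alpha> 0]) (use that F_intros in auto)
  have "is_subfield E"
    unfolding is_subfield_def
  proof (intro conjI ballI)
    show "0 \<in> E" "1 \<in> E"
      by (intro FE F_intros)+
  next
    fix a b assume "a \<in> E" "b \<in> E"
    then obtain \<alpha> \<beta> \<gamma> \<delta> where ab: "a = \<alpha> + \<beta> * r" "b = \<gamma> + \<delta> * r"
      and mem: "\<alpha> \<in> F" "\<beta> \<in> F" "\<gamma> \<in> F" "\<delta> \<in> F"
      unfolding E_def by blast
    show "a + b \<in> E"
      by (rule EI[of _ "\<alpha> + \<gamma>" "\<beta> + \<delta>"]) (intro F_intros mem | simp add: ab algebra_simps)+
    show "a * b \<in> E"
      by (rule EI[of _ "\<alpha> * \<gamma> + \<beta> * \<delta> * r\<^sup>2" "\<alpha> * \<delta> + \<beta> * \<gamma>"])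
        (intro F_intros mem r | simp add: ab algebra_simps power2_eq_square)+
  next
    fix a assume "a \<in> E"
    then obtain \<alpha> \<beta> where a: "a = \<alpha> + \<beta> * r" and mem: "\<alpha> \<in> F" "\<beta> \<in> F"
      unfolding E_def by blast
    show "- a \<in> E"
      by (rule EI[of _ "- \<alpha>" "- \<beta>"]) (intro F_intros mem | simp add: a algebra_simps)+
    show "inverse a \<in> E"
    proof (cases "\<beta> = 0")
      case True
      then show ?thesis
        using a mem by (auto intro!: FE F_intros)
    next
      case False
      \<comment> \<open>The norm of \<open>a\<close>; if one of its two factors vanished,
        \<open>r\<close> would lie in \<open>F\<close>.\<close>
      define n where "n = \<alpha>\<^sup>2 - \<beta>\<^sup>2 * r\<^sup>2"
      have n: "n = (\<alpha> + \<beta> * r) * (\<alpha> - \<beta> * r)"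
        by (simp add: n_def algebra_simps power2_eq_square)
      have "\<alpha> + \<beta> * r \<noteq> 0" "\<alpha> - \<beta> * r \<noteq> 0"
      proof -
        have "r = - \<alpha> / \<beta>" if "\<alpha> + \<beta> * r = 0"
          using that False by (simp add: field_simps eq_neg_iff_add_eq_0)
        moreover have "r = \<alpha> / \<beta>" if "\<alpha> - \<beta> * r = 0"
          using that False by (simp add: field_simps)
        ultimately show "\<alpha> + \<beta> * r \<noteq> 0" "\<alpha> - \<beta> * r \<noteq> 0"
          using \<open>r \<notin> F\<close> mem by (metis F_intros(5,8))+
      qed
      then have "inverse a = \<alpha> / n + - \<beta> / n * r"
        unfolding n a by (simp add: divide_simps)
      moreover have "n \<in> F"
        unfolding n_def by (intro F_intros mem r)
      ultimately show ?thesis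
        by (intro EI[of _ "\<alpha> / n" "- \<beta> / n"]) (simp_all add: F_intros mem)
    qed
  qed
  moreover have "F \<subseteq> E"
    using FE by blast
  moreover have "r \<in> E"
    by (rule EI[of _ 0 1]) (intro F_intros | simp)+
  ultimately have "gen_field F {r} \<subseteq> E"
    by (intro gen_field_least) simp_all
  then show ?thesis
    using that z unfolding E_def by blast
qed

text \<open>A relation splits as q + r s with \<open>q\<close> and \<open>s\<close> over
  \<open>F\<close>, and its vanishing at \<open>x\<close> gives q^2 = r^2 s^2 as polynomials over
  \<open>F\<close>. Comparing leading coefficients, a nonzero \<open>s\<close> would put
  \<open>r\<close> into \<open>F\<close>.\<close>

lemma transc_sqrt:
  assumes F: "is_subfield F" and x: "transc F x" and r: "r\<^sup>2 \<in> F"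
  shows "transc (gen_field F {r}) x"
proof (cases "r \<in> F")
  case True
  then have "gen_field F {r} \<subseteq> F"
    using F by (intro gen_field_least) auto
  then show ?thesis
    by (rule transc_mono[OF x])
next
  case False
  note Fr = is_subfield_imp_is_subring[OF F]
  show ?thesis
    unfolding transc_def
  proof (intro allI impI)
    fix p assume p: "coeffs_in (gen_field F {r}) p" "poly p x = 0"
    have "\<exists>q s. coeffs_in F q \<and> coeffs_in F s \<and> p = q + smult r s"
      using p(1)
    proof (induction p)
      case 0
      then show ?case
        using subfield_0[OF F] by (intro exI[of _ 0]) simp
    next
      case (pCons a p)
      then obtain q s where qs: "coeffs_in F q" "coeffs_in F s" "p = q + smult r s"
        by auto
      obtain \<alpha> \<beta> where "\<alpha> \<in> F" "\<beta> \<in> F" "a = \<alpha> + \<beta> * r"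
        using pCons.prems gen_field_sqrtE[OF F r] by (metis coeffs_in_pCons)
      then show ?case
        using qs by (intro exI[of _ "pCons \<alpha> q"] exI[of _ "pCons \<beta> s"]) (simp add: mult.commute)
    qed
    then obtain q s where q: "coeffs_in F q" and s: "coeffs_in F s" and pqs: "p = q + smult r s"
      by blast
    have "poly q x = - r * poly s x"
      using p(2) by (simp add: pqs eq_neg_iff_add_eq_0)
    then have "poly (q\<^sup>2) x = poly ([:r\<^sup>2:] * s\<^sup>2) x"
      by (simp add: power_mult_distrib)
    moreover have "coeffs_in F [:r\<^sup>2:]"
      using r subfield_0[OF F] by simp
    then have "coeffs_in F (q\<^sup>2)" "coeffs_in F ([:r\<^sup>2:] * s\<^sup>2)"
      by (intro coeffs_in_mult coeffs_in_power Fr q s; assumption)+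
    ultimately have eq: "q\<^sup>2 = [:r\<^sup>2:] * s\<^sup>2"
      by (intro transc_eqD[OF x Fr])
    have "s = 0"
    proof (rule ccontr)
      assume "s \<noteq> 0"
      have "(lead_coeff q)\<^sup>2 = (r * lead_coeff s)\<^sup>2"
        using arg_cong[OF eq, of lead_coeff] by (simp add: lead_coeff_power power_mult_distrib)
      then have "lead_coeff q = r * lead_coeff s \<or> lead_coeff q = - (r * lead_coeff s)"
        by (simp add: power2_eq_iff)
      then have "r = lead_coeff q / lead_coeff s \<or> r = - (lead_coeff q / lead_coeff s)"
        using \<open>s \<noteq> 0\<close> by auto
      moreover have "lead_coeff q / lead_coeff s \<in> F"
        using q s subfield_divide[OF F] by (auto simp: coeffs_in_def)
      ultimately show False
        using False subfield_uminus[OF F] by metis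
    qed
    then show "p = 0"
      using eq pqs by simp
  qed
qed

text \<open>If \<open>y\<close> were n(x)/d(x), then n^2 = p d^2 as polynomials, and the two degrees
  would have opposite parity.\<close>

lemma sqrt_odd_degree_notin:
  assumes F: "is_subring F" and x: "transc F x"
    and p: "coeffs_in F p" "odd (degree p)" and y: "y\<^sup>2 = poly p x"
  shows "y \<notin> gen_field F {x}"
proof
  assume "y \<in> gen_field F {x}"
  then obtain n d where nd: "coeffs_in F n" "coeffs_in F d" "poly d x \<noteq> 0" "y = poly n x / poly d x"
    using gen_field_singletonE[OF F] by metis
  have "n\<^sup>2 = p * d\<^sup>2"
  proof (rule transc_eqD[OF x F])
    show "poly (n\<^sup>2) x = poly (p * d\<^sup>2) x"
      using nd(3) y by (simp add: nd(4) field_simps)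
  qed (intro coeffs_in_mult coeffs_in_power F nd p)+
  moreover have "d \<noteq> 0" "p \<noteq> 0"
    using nd(3) p(2) by auto
  ultimately have "2 * degree n = degree p + 2 * degree d"
    by (metis degree_mult_eq degree_power_eq mult_eq_0_iff power_eq_0_iff zero_neq_numeral
        degree_power_eq zero_power2)
  then show False
    using p(2) by presburger
qed

section \<open>Homomorphisms controlled only on a subfield\<close>

context
  fixes K F :: "'f::field set" and \<phi>
  assumes F: "is_subfield F" and hom: "K_hom_on K F \<phi>"
begin

lemma hom_1: "\<phi> 1 = 1"
  and hom_add: "a \<in> F \<Longrightarrow> b \<in> F \<Longrightarrow> \<phi> (a + b) = \<phi> a + \<phi> b"
  and hom_mult: "a \<in> F \<Longrightarrow> b \<in> F \<Longrightarrow> \<phi> (a * b) = \<phi> a * \<phi> b"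
  and hom_base: "a \<in> K \<Longrightarrow> \<phi> a = a"
  using hom by (auto simp: K_hom_on_def)

lemma hom_0: "\<phi> 0 = 0"
  using hom_add[of 0 0] subfield_0[OF F] by (metis add.right_neutral add_left_cancel)

lemma hom_uminus: "a \<in> F \<Longrightarrow> \<phi> (- a) = - \<phi> a"
  using hom_add[of "- a" a] hom_0 subfield_uminus[OF F] by (simp add: eq_neg_iff_add_eq_0)

lemma hom_diff: "a \<in> F \<Longrightarrow> b \<in> F \<Longrightarrow> \<phi> (a - b) = \<phi> a - \<phi> b"
  using hom_add[of a "- b"] hom_uminus[of b] subfield_uminus[OF F] by simp

lemma hom_inverse: "a \<in> F \<Longrightarrow> \<phi> (inverse a) = inverse (\<phi> a)"
  using hom_mult[of "inverse a" a] hom_0 hom_1 subfield_inverse[OF F, of a]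
  by (cases "a = 0") (auto intro: inverse_unique[symmetric] simp: mult.commute)

lemma hom_divide: "a \<in> F \<Longrightarrow> b \<in> F \<Longrightarrow> \<phi> (a / b) = \<phi> a / \<phi> b"
  using hom_mult[of a "inverse b"] hom_inverse[of b] subfield_inverse[OF F]
  by (simp add: divide_inverse)

lemma hom_power: "a \<in> F \<Longrightarrow> \<phi> (a ^ n) = \<phi> a ^ n"
  by (induction n) (simp_all add: hom_1 hom_mult subfield_power[OF F])

lemma hom_eq_0_iff: "a \<in> F \<Longrightarrow> \<phi> a = 0 \<longleftrightarrow> a = 0"
  using hom_mult[of a "inverse a"] hom_0 hom_1 subfield_inverse[OF F, of a] by (cases "a = 0") auto

lemma hom_inj_on: "inj_on \<phi> F"
proof (rule inj_onI)
  fix a b assume "a \<in> F" "b \<in> F" "\<phi> a = \<phi> b"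
  then show "a = b"
    using hom_diff[of a b] hom_eq_0_iff[of "a - b"] subfield_diff[OF F] by simp
qed

lemma hom_sum: "(\<And>i. i \<in> I \<Longrightarrow> f i \<in> F) \<Longrightarrow> \<phi> (sum f I) = (\<Sum>i\<in>I. \<phi> (f i))"
proof (induction I rule: infinite_finite_induct)
  case (insert i I)
  then show ?case
    using hom_add[of "f i" "sum f I"] is_subring_sum[OF is_subfield_imp_is_subring[OF F], of I f]
    by simp
qed (simp_all add: hom_0)

lemma map_poly_hom_add:
  assumes "coeffs_in F p" "coeffs_in F q"
  shows "map_poly \<phi> (p + q) = map_poly \<phi> p + map_poly \<phi> q"
  using assms by (intro poly_eqI) (simp add: coeff_map_poly hom_0 hom_add coeffs_in_def)

lemma map_poly_hom_mult:
  assumes "coeffs_in F p" "coeffs_in F q"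
  shows "map_poly \<phi> (p * q) = map_poly \<phi> p * map_poly \<phi> q"
proof (rule poly_eqI)
  fix n
  have "\<phi> (\<Sum>i\<le>n. coeff p i * coeff q (n - i)) = (\<Sum>i\<le>n. \<phi> (coeff p i * coeff q (n - i)))"
    using assms by (intro hom_sum) (simp add: coeffs_in_def subfield_mult[OF F])
  then show "coeff (map_poly \<phi> (p * q)) n = coeff (map_poly \<phi> p * map_poly \<phi> q) n"
    using assms by (simp add: coeff_map_poly hom_0 coeff_mult coeffs_in_def hom_mult)
qed

lemma map_poly_hom_eq_0_iff: "coeffs_in F p \<Longrightarrow> map_poly \<phi> p = 0 \<longleftrightarrow> p = 0"
  by (auto simp: poly_eq_iff coeff_map_poly hom_0 coeffs_in_def hom_eq_0_iff)

end

section \<open>Extension of homomorphisms\<close>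

lemma K_hom_on_mono: "K_hom_on K F \<phi> \<Longrightarrow> E \<subseteq> F \<Longrightarrow> K_hom_on K E \<phi>"
  unfolding K_hom_on_def by blast

text \<open>The elements that \<open>\<phi>\<close> sends into \<open>G\<close> form a subfield, so
  it suffices to look at generators.\<close>

lemma hom_image_gen_field:
  assumes hom: "K_hom_on K (gen_field F S) \<phi>"
    and G: "is_subfield G" and "\<phi> ` F \<subseteq> G" "\<phi> ` S \<subseteq> G"
  shows "\<phi> ` gen_field F S \<subseteq> G"
proof -
  let ?E = "{z \<in> gen_field F S. \<phi> z \<in> G}"
  note E = is_subfield_gen_field[of F S]
  have "is_subfield ?E"
    unfolding is_subfield_def
    by (auto simp: hom_0[OF E hom] hom_1[OF E hom] hom_add[OF E hom] hom_mult[OF E hom]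
        hom_uminus[OF E hom] hom_inverse[OF E hom] intro: subfield_intros[OF E] subfield_intros[OF G])
  moreover have "F \<subseteq> ?E" "S \<subseteq> ?E"
    using assms(3,4) base_subset_gen_field[of F S] gens_subset_gen_field[of S F] by auto
  ultimately have "gen_field F S \<subseteq> ?E"
    by (rule gen_field_least)
  then show ?thesis by blast
qed

text \<open>The fixed elements of a homomorphism form a subfield.\<close>

lemma hom_fixes_gen_field:
  assumes F: "is_subfield F" and hom: "K_hom_on K F \<phi>" and "K \<subseteq> F" "S \<subseteq> F"
    and gens: "\<And>s. s \<in> S \<Longrightarrow> \<phi> s = s" and "z \<in> gen_field K S"
  shows "\<phi> z = z"
proof -
  let ?E = "{z \<in> F. \<phi> z = z}"
  have "is_subfield ?E"
    unfolding is_subfield_def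
    by (auto simp: hom_0[OF F hom] hom_1[OF F hom] hom_add[OF F hom] hom_mult[OF F hom]
        hom_uminus[OF F hom] hom_inverse[OF F hom] intro: subfield_intros[OF F])
  moreover have "K \<subseteq> ?E" "S \<subseteq> ?E"
    using assms hom_base[OF F hom] by auto
  ultimately have "gen_field K S \<subseteq> ?E"
    by (rule gen_field_least)
  then show ?thesis using \<open>z \<in> gen_field K S\<close> by blast
qed

text \<open>An extension is prescribed through representatives of its arguments; \<open>R\<close> is
  its graph, and \<open>unique\<close> says that the choice of representative does not
  matter.\<close>

lemma hom_of_relation:
  assumes total: "\<And>z. z \<in> S \<Longrightarrow> \<exists>w. R z w"
    and unique: "\<And>z w w'. R z w \<Longrightarrow> R z w' \<Longrightarrow> w = w'"
    and add: "\<And>z w z' w'. R z w \<Longrightarrow> R z' w' \<Longrightarrow> R (z + z') (w + w')"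
    and mult: "\<And>z w z' w'. R z w \<Longrightarrow> R z' w' \<Longrightarrow> R (z * z') (w * w')"
    and base: "\<And>c. c \<in> K \<Longrightarrow> R c c" and "1 \<in> K"
  obtains \<psi> where "K_hom_on K S \<psi>" "\<And>z w. R z w \<Longrightarrow> \<psi> z = w"
proof -
  define \<psi> where "\<psi> z = (THE w. R z w)" for z
  have \<psi>: "\<psi> z = w" if "R z w" for z w
    unfolding \<psi>_def using that unique by blast
  have "R z (\<psi> z)" if "z \<in> S" for z
    using total[OF that] \<psi> by blast
  then have "K_hom_on K S \<psi>"
    unfolding K_hom_on_def using add mult base \<open>1 \<in> K\<close> by (auto intro!: \<psi>)
  then show ?thesis
    using that \<psi> by blast
qed

text \<open>A quotient p(x)/q(x) goes to the quotient of the transported polynomials at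
  \<open>y\<close>. Transcendence of \<open>x\<close> makes this well defined; transcendence of
  \<open>y\<close> over \<open>G\<close> keeps the denominators nonzero.\<close>

lemma extend_hom_transc:
  assumes F: "is_subfield F" and hom: "K_hom_on K F \<phi>" and K: "K \<subseteq> F" "1 \<in> K"
    and x: "transc F x" and y: "transc G y" and im: "\<phi> ` F \<subseteq> G"
  obtains \<psi> where "K_hom_on K (gen_field F {x}) \<psi>" "\<psi> x = y" "\<And>z. z \<in> F \<Longrightarrow> \<psi> z = \<phi> z"
proof -
  note Fr = is_subfield_imp_is_subring[OF F]
  note F0 = subfield_0[OF F] and F1 = subfield_1[OF F]
  let ?m = "map_poly \<phi>"
  define R where "R z w \<longleftrightarrow> (\<exists>p q. coeffs_in F p \<and> coeffs_in F q \<and> poly q x \<noteq> 0 \<and>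
    z = poly p x / poly q x \<and> w = poly (?m p) y / poly (?m q) y)" for z w
  have RI: "R z w" if "coeffs_in F p" "coeffs_in F q" "poly q x \<noteq> 0"
    "z = poly p x / poly q x" "w = poly (?m p) y / poly (?m q) y" for p q z w
    using that R_def by blast
  have nz: "poly (?m q) y \<noteq> 0" if "coeffs_in F q" "poly q x \<noteq> 0" for q
  proof
    assume "poly (?m q) y = 0"
    moreover have "coeffs_in G (?m q)"
      using that(1) im by (auto simp: coeffs_in_def coeff_map_poly hom_0[OF F hom])
    ultimately have "?m q = 0"
      using transcD[OF y] by blast
    then show False
      using that map_poly_hom_eq_0_iff[OF F hom] by auto
  qed
  have const: "R z (\<phi> z)" if "z \<in> F" for z
    using that F0 F1
    by (intro RI[of "[:z:]" "[:1:]"]) (auto simp: map_poly_pCons hom_0[OF F hom] hom_1[OF F hom])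
  obtain \<psi> where \<psi>: "K_hom_on K (gen_field F {x}) \<psi>" "\<And>z w. R z w \<Longrightarrow> \<psi> z = w"
  proof (rule hom_of_relation[where S = "gen_field F {x}" and R = R and K = K])
    fix z assume "z \<in> gen_field F {x}"
    then show "\<exists>w. R z w"
      using gen_field_singletonE[OF Fr] RI by metis
  next
    fix z w w' assume "R z w" "R z w'"
    then obtain p q p' q' where pq: "coeffs_in F p" "coeffs_in F q" "poly q x \<noteq> 0"
      "z = poly p x / poly q x" "w = poly (?m p) y / poly (?m q) y"
      and pq': "coeffs_in F p'" "coeffs_in F q'" "poly q' x \<noteq> 0"
      "z = poly p' x / poly q' x" "w' = poly (?m p') y / poly (?m q') y"
      unfolding R_def by blast
    \<comment> \<open>Cross-multiplying turns the equality of fractions into a polynomial identity,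
      which \<open>\<phi>\<close> transports.\<close>
    have "poly (p * q') x = poly (p' * q) x"
      using pq(3,4) pq'(3,4) by (simp add: field_simps)
    then have "p * q' = p' * q"
      by (intro transc_eqD[OF x Fr] coeffs_in_mult Fr pq pq')
    then have "?m p * ?m q' = ?m p' * ?m q"
      using pq pq' by (metis map_poly_hom_mult[OF F hom])
    then have "poly (?m p) y * poly (?m q') y = poly (?m p') y * poly (?m q) y"
      by (metis poly_mult)
    then show "w = w'"
      using nz[OF pq(2,3)] nz[OF pq'(2,3)] by (simp add: pq(5) pq'(5) field_simps)
  next
    fix z w z' w' assume "R z w" "R z' w'"
    then obtain p q p' q' where pq: "coeffs_in F p" "coeffs_in F q" "poly q x \<noteq> 0"
      "z = poly p x / poly q x" "w = poly (?m p) y / poly (?m q) y"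
      and pq': "coeffs_in F p'" "coeffs_in F q'" "poly q' x \<noteq> 0"
      "z' = poly p' x / poly q' x" "w' = poly (?m p') y / poly (?m q') y"
      unfolding R_def by blast
    note nzs = nz[OF pq(2,3)] nz[OF pq'(2,3)]
    have c: "coeffs_in F (p * q')" "coeffs_in F (p' * q)"
      by (intro coeffs_in_mult Fr pq pq')+
    show "R (z + z') (w + w')"
    proof (rule RI[of "p * q' + p' * q" "q * q'"])
      show "w + w' = poly (?m (p * q' + p' * q)) y / poly (?m (q * q')) y"
        using nzs pq pq' c
        by (simp add: map_poly_hom_add[OF F hom] map_poly_hom_mult[OF F hom] add_frac_eq)
      show "z + z' = poly (p * q' + p' * q) x / poly (q * q') x"
        using pq pq' by (simp add: add_frac_eq)
    qed (use pq pq' in \<open>simp_all add: coeffs_in_add coeffs_in_mult Fr\<close>)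
    show "R (z * z') (w * w')"
      by (rule RI[of "p * p'" "q * q'"])
        (use pq pq' in \<open>simp_all add: coeffs_in_mult Fr map_poly_hom_mult[OF F hom]\<close>)
  next
    fix c assume "c \<in> K"
    then show "R c c"
      using const[of c] hom_base[OF F hom, of c] K(1) by auto
  qed (use K in auto)
  show ?thesis
  proof
    show "K_hom_on K (gen_field F {x}) \<psi>" by fact
    show "\<psi> x = y"
      using F0 F1
      by (intro \<psi>(2) RI[of "[:0, 1:]" "[:1:]"])
        (auto simp: map_poly_pCons hom_0[OF F hom] hom_1[OF F hom])
    show "\<psi> z = \<phi> z" if "z \<in> F" for z
      using \<psi>(2) const[OF that] by blast
  qed
qed

text \<open>As \<open>r\<close> is not in \<open>F\<close>, the form
  \<open>\<alpha> + \<beta> * r\<close> is unique and \<open>r\<close> can be sent to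
  \<open>s\<close>; the condition on \<open>s\<close> makes the result multiplicative.\<close>

lemma extend_hom_sqrt:
  assumes F: "is_subfield F" and hom: "K_hom_on K F \<phi>" and K: "K \<subseteq> F" "1 \<in> K"
    and r: "r\<^sup>2 \<in> F" "r \<notin> F" and s: "s\<^sup>2 = \<phi> (r\<^sup>2)"
  obtains \<psi> where "K_hom_on K (gen_field F {r}) \<psi>" "\<psi> r = s" "\<And>z. z \<in> F \<Longrightarrow> \<psi> z = \<phi> z"
proof -
  note F_intros = subfield_intros[OF F]
  note hom_simps = hom_0[OF F hom] hom_1[OF F hom] hom_add[OF F hom] hom_mult[OF F hom]
  define R where "R z w \<longleftrightarrow> (\<exists>\<alpha>\<in>F. \<exists>\<beta>\<in>F. z = \<alpha> + \<beta> * r \<and> w = \<phi> \<alpha> + \<phi> \<beta> * s)" for z w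
  have RI: "R z w" if "\<alpha> \<in> F" "\<beta> \<in> F" "z = \<alpha> + \<beta> * r" "w = \<phi> \<alpha> + \<phi> \<beta> * s" for z w \<alpha> \<beta>
    using that R_def by blast
  have const: "R z (\<phi> z)" if "z \<in> F" for z
    by (rule RI[of z 0]) (use that F_intros in \<open>auto simp: hom_simps\<close>)
  obtain \<psi> where \<psi>: "K_hom_on K (gen_field F {r}) \<psi>" "\<And>z w. R z w \<Longrightarrow> \<psi> z = w"
  proof (rule hom_of_relation[where S = "gen_field F {r}" and R = R and K = K])
    fix z assume "z \<in> gen_field F {r}"
    then show "\<exists>w. R z w"
      using gen_field_sqrtE[OF F r(1)] RI by metis
  next
    fix z w w' assume "R z w" "R z w'"
    then obtain \<alpha> \<beta> \<gamma> \<delta> where mem: "\<alpha> \<in> F" "\<beta> \<in> F" "\<gamma> \<in> F" "\<delta> \<in> F"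
      and eq: "\<alpha> + \<beta> * r = \<gamma> + \<delta> * r" and w: "w = \<phi> \<alpha> + \<phi> \<beta> * s" "w' = \<phi> \<gamma> + \<phi> \<delta> * s"
      unfolding R_def by metis
    have "\<beta> = \<delta>"
    proof (rule ccontr)
      assume "\<beta> \<noteq> \<delta>"
      then have "r = (\<gamma> - \<alpha>) / (\<beta> - \<delta>)"
        using eq by (simp add: field_simps)
      also have "\<dots> \<in> F"
        by (intro F_intros mem)
      finally show False using r by simp
    qed
    then show "w = w'"
      using eq w by simp
  next
    fix z w z' w' assume "R z w" "R z' w'"
    then obtain \<alpha> \<beta> \<gamma> \<delta> where mem: "\<alpha> \<in> F" "\<beta> \<in> F" "\<gamma> \<in> F" "\<delta> \<in> F"
      and z: "z = \<alpha> + \<beta> * r" "z' = \<gamma> + \<delta> * r"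
      and w: "w = \<phi> \<alpha> + \<phi> \<beta> * s" "w' = \<phi> \<gamma> + \<phi> \<delta> * s"
      unfolding R_def by blast
    show "R (z + z') (w + w')"
      by (rule RI[of "\<alpha> + \<gamma>" "\<beta> + \<delta>"])
        (simp_all add: z w mem hom_simps F_intros algebra_simps)
    have "\<phi> (\<alpha> * \<gamma> + \<beta> * \<delta> * r\<^sup>2) = \<phi> \<alpha> * \<phi> \<gamma> + \<phi> \<beta> * \<phi> \<delta> * s\<^sup>2"
      "\<phi> (\<alpha> * \<delta> + \<beta> * \<gamma>) = \<phi> \<alpha> * \<phi> \<delta> + \<phi> \<beta> * \<phi> \<gamma>"
      unfolding s by (simp_all add: mem r hom_simps F_intros)
    then show "R (z * z') (w * w')"
      by (intro RI[of "\<alpha> * \<gamma> + \<beta> * \<delta> * r\<^sup>2" "\<alpha> * \<delta> + \<beta> * \<gamma>"] F_intros mem r)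
        (simp_all add: z w algebra_simps power2_eq_square)
  next
    fix c assume "c \<in> K"
    then show "R c c"
      using const[of c] hom_base[OF F hom, of c] K(1) by auto
  qed (use K in auto)
  show ?thesis
  proof
    show "K_hom_on K (gen_field F {r}) \<psi>" by fact
    show "\<psi> r = s"
      by (intro \<psi>(2) RI[of 0 1] F_intros) (simp_all add: hom_simps)
    show "\<psi> z = \<phi> z" if "z \<in> F" for z
      using \<psi>(2) const[OF that] by blast
  qed
qed

lemma transc_divide_const:
  assumes F: "is_subfield F" and x: "transc F x" and c: "c \<in> F" "c \<noteq> 0"
  shows "transc F (x / c)"
proof -
  note F01 = subfield_0[OF F] subfield_1[OF F]
  have "transc F (poly [:0, 1 / c:] x / poly [:1:] x)"
    by (rule transc_rational[OF is_subfield_imp_is_subring[OF F] x])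
      (use c F01 subfield_divide[OF F F01(2) c(1)] in auto)
  then show ?thesis by simp
qed

text \<open>The map (x, y) to (e^2 x, e y) preserves the curve because e^4 = 1: a primitive fourth
  root of unity gives the action of \<open>g\<close>, and e = -1 the sign change of
  \<open>y\<close>. The extension passes first through the transcendental \<open>x\<close>, then
  through \<open>y\<close>, which is not in F(x) because the cubic has odd degree. Stability of the
  image lets a further curve be adjoined on top.\<close>

lemma extend_hom_curve:
  assumes F: "is_subfield F" and hom: "K_hom_on K F \<phi>" and K: "K \<subseteq> F" "1 \<in> K"
    and im: "\<phi> ` F \<subseteq> F" and x: "transc F x" and y: "y\<^sup>2 = x ^ 3 - x"
    and e: "e \<in> K" "e ^ 4 = 1"
  obtains \<psi> where "K_hom_on K (gen_field F {x, y}) \<psi>"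
    "\<psi> ` gen_field F {x, y} \<subseteq> gen_field F {x, y}"
    "\<psi> x = e\<^sup>2 * x" "\<psi> y = e * y" "\<And>z. z \<in> F \<Longrightarrow> \<psi> z = \<phi> z"
proof -
  let ?E = "gen_field F {x}"
  note E = is_subfield_gen_field[of F "{x}"]
  note F01 = subfield_0[OF F] subfield_1[OF F]
  have xE: "x \<in> ?E"
    using gens_subset_gen_field[of "{x}" F] by simp
  have FE: "F \<subseteq> ?E"
    by (rule base_subset_gen_field)
  have e0: "e \<noteq> 0" and eF: "e \<in> F"
    using e K by auto
  \<comment> \<open>Multiplication by \<open>e\<^sup>2\<close> is written as a division to reuse
    \<open>transc_divide_const\<close>.\<close>
  have "transc F (x / (1 / e\<^sup>2))"
    using e0 eF by (intro transc_divide_const F x subfield_intros[OF F]) simp_all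
  then have "transc F (e\<^sup>2 * x)"
    by (simp add: mult.commute)
  then obtain \<rho> where \<rho>: "K_hom_on K ?E \<rho>" "\<rho> x = e\<^sup>2 * x" "\<And>z. z \<in> F \<Longrightarrow> \<rho> z = \<phi> z"
    using extend_hom_transc[OF F hom K x _ im] by metis
  have y2E: "y\<^sup>2 \<in> ?E"
    unfolding y by (intro subfield_intros[OF E] xE)
  have "y \<notin> ?E"
    by (rule sqrt_odd_degree_notin[OF is_subfield_imp_is_subring[OF F] x, of "[:0, -1, 0, 1:]"])
      (use F01 subfield_uminus[OF F F01(2)] in \<open>auto simp: y algebra_simps power3_eq_cube\<close>)
  have "(e * y)\<^sup>2 = e\<^sup>2 * (x ^ 3 - x)"
    by (simp add: power_mult_distrib y)
  also have "\<dots> = (e\<^sup>2 * x) ^ 3 - e\<^sup>2 * x"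
  proof -
    have "(e\<^sup>2 * x) ^ 3 = e ^ 4 * e\<^sup>2 * x ^ 3"
      by (simp add: power_mult_distrib flip: power_mult power_add)
    then show ?thesis
      by (simp only: e mult_1_left right_diff_distrib)
  qed
  also have "\<dots> = \<rho> (y\<^sup>2)"
    by (simp add: y hom_diff[OF E \<rho>(1)] hom_power[OF E \<rho>(1)] subfield_power[OF E] xE \<rho>(2))
  finally obtain \<psi> where \<psi>: "K_hom_on K (gen_field ?E {y}) \<psi>" "\<psi> y = e * y"
    "\<And>z. z \<in> ?E \<Longrightarrow> \<psi> z = \<rho> z"
    using extend_hom_sqrt[OF E \<rho>(1) order.trans[OF K(1) FE] K(2) y2E \<open>y \<notin> ?E\<close>] by metis
  have eq: "gen_field ?E {y} = gen_field F {x, y}"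
    by (simp add: gen_field_gen_field insert_commute)
  let ?G = "gen_field F {x, y}"
  note G = is_subfield_gen_field[of F "{x, y}"]
  have FG: "F \<subseteq> ?G" and xyG: "x \<in> ?G" "y \<in> ?G"
    using base_subset_gen_field[of F "{x, y}"] gens_subset_gen_field[of "{x, y}" F] by auto
  have vals: "\<psi> x = e\<^sup>2 * x" "\<psi> z = \<phi> z" if "z \<in> F" for z
    using \<psi>(3) \<rho> xE FE that by auto
  have x': "\<psi> x = e\<^sup>2 * x"
    using vals(1)[OF F01(1)] .
  have "\<psi> ` F \<subseteq> ?G"
    using vals(2) im FG by fastforce
  moreover have "\<psi> ` {x, y} \<subseteq> ?G"
    using eF FG by (auto simp: x' \<psi>(2) intro!: subfield_mult[OF G] subfield_power[OF G] xyG)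
  ultimately have "\<psi> ` ?G \<subseteq> ?G"
    using \<psi>(1) by (intro hom_image_gen_field[where K = K] G) (simp_all add: eq)
  then show ?thesis
    using that \<psi>(1,2) x' vals(2) by (simp add: eq)
qed

section \<open>The function field of the triple product\<close>

locale curve_triple =
  fixes K :: "'f::field set" and x1 y1 x2 y2 x3 y3 :: 'f
  assumes K: "is_subfield K" and indep: "alg_indep3 K x1 x2 x3"
    and y1: "y1\<^sup>2 = x1 ^ 3 - x1" and y2: "y2\<^sup>2 = x2 ^ 3 - x2" and y3: "y3\<^sup>2 = x3 ^ 3 - x3"
begin

abbreviation Z where "Z \<equiv> gen_field K {x1, y1, x2, y2, x3, y3}"

lemmas Z = is_subfield_gen_field[of K "{x1, y1, x2, y2, x3, y3}"]

lemma K_subset_Z: "K \<subseteq> Z" and mem_Z: "x1 \<in> Z" "y1 \<in> Z" "x2 \<in> Z" "y2 \<in> Z" "x3 \<in> Z" "y3 \<in> Z"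
  by (rule base_subset_gen_field) (simp_all add: mem_gen_field)

lemmas tower = alg_indep3_tower[OF K indep]

text \<open>The curves are adjoined in the order 3, 2, 1 with independent roots of unity, so that
  both \<open>g\<close> and the sign change of a single \<open>y\<close>-coordinate are special
  cases.\<close>

lemma curve_action:
  assumes e: "e1 \<in> K" "e1 ^ 4 = 1" "e2 \<in> K" "e2 ^ 4 = 1" "e3 \<in> K" "e3 ^ 4 = 1"
  obtains \<sigma> where "K_hom_on K Z \<sigma>"
    "\<sigma> x1 = e1\<^sup>2 * x1" "\<sigma> y1 = e1 * y1" "\<sigma> x2 = e2\<^sup>2 * x2" "\<sigma> y2 = e2 * y2"
    "\<sigma> x3 = e3\<^sup>2 * x3" "\<sigma> y3 = e3 * y3"
proof -
  note K1 = subfield_1[OF K]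
  let ?E = "gen_field K {x3, y3}" and ?G = "gen_field K {x2, y2, x3, y3}"
  have E_eq: "gen_field ?E {x2, y2} = ?G" and G_eq: "gen_field ?G {x1, y1} = Z"
    by (simp_all add: gen_field_gen_field insert_commute)
  note E = is_subfield_gen_field[of K "{x3, y3}"] and G = is_subfield_gen_field[of K "{x2, y2, x3, y3}"]
  have KE: "K \<subseteq> ?E" and KG: "K \<subseteq> ?G"
    by (intro base_subset_gen_field)+
  have xyE: "x3 \<in> ?E" "y3 \<in> ?E" and xyG: "x3 \<in> ?G" "y3 \<in> ?G" "x2 \<in> ?G" "y2 \<in> ?G"
    by (simp_all add: mem_gen_field)
  have sq: "y ^ 2 \<in> gen_field K S" if "y ^ 2 = x ^ 3 - x" "x \<in> S" for x y S
    unfolding that(1) using that(2)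
    by (intro subfield_intros[OF is_subfield_gen_field] mem_gen_field)
  \<comment> \<open>The tower concerns only the \<open>x\<close>-coordinates; adjoining a
    \<open>y\<close>-coordinate, which is a square root, preserves transcendence.\<close>
  have "transc (gen_field (gen_field K {x3}) {y3}) x2"
    by (rule transc_sqrt[OF is_subfield_gen_field tower(2) sq[OF y3]]) simp
  then have tE: "transc ?E x2"
    by (simp add: gen_field_gen_field insert_commute)
  have "transc (gen_field (gen_field K {x3, x2}) {y3}) x1"
    by (rule transc_sqrt[OF is_subfield_gen_field tower(3) sq[OF y3]]) simp
  then have "transc (gen_field K {x3, x2, y3}) x1"
    by (simp add: gen_field_gen_field insert_commute)
  then have "transc (gen_field (gen_field K {x3, x2, y3}) {y2}) x1"
    by (rule transc_sqrt[OF is_subfield_gen_field _ sq[OF y2]]) simp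
  then have tG: "transc ?G x1"
    by (simp add: gen_field_gen_field insert_commute)
  have "K_hom_on K K (\<lambda>z. z)"
    by (simp add: K_hom_on_def)
  from extend_hom_curve[OF K this _ K1 _ tower(1) y3 e(5,6)]
  obtain \<sigma>1 where \<sigma>1: "K_hom_on K ?E \<sigma>1" "\<sigma>1 ` ?E \<subseteq> ?E"
    "\<sigma>1 x3 = e3\<^sup>2 * x3" "\<sigma>1 y3 = e3 * y3"
    by (metis image_ident order_refl)
  from extend_hom_curve[OF E \<sigma>1(1) KE K1 \<sigma>1(2) tE y2 e(3,4)]
  obtain \<sigma>2 where \<sigma>2: "K_hom_on K ?G \<sigma>2" "\<sigma>2 ` ?G \<subseteq> ?G"
    "\<sigma>2 x2 = e2\<^sup>2 * x2" "\<sigma>2 y2 = e2 * y2" "\<And>z. z \<in> ?E \<Longrightarrow> \<sigma>2 z = \<sigma>1 z"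
    by (metis E_eq)
  from extend_hom_curve[OF G \<sigma>2(1) KG K1 \<sigma>2(2) tG y1 e(1,2)]
  obtain \<sigma> where \<sigma>: "K_hom_on K Z \<sigma>" "\<sigma> x1 = e1\<^sup>2 * x1" "\<sigma> y1 = e1 * y1"
    "\<And>z. z \<in> ?G \<Longrightarrow> \<sigma> z = \<sigma>2 z"
    by (metis G_eq)
  show ?thesis
    by (rule that[of \<sigma>]) (use \<sigma> \<sigma>2 \<sigma>1 xyE xyG in auto)
qed

section \<open>Invariant coordinates on the quotient\<close>

definition a where "a = x2 / x3"
definition b where "b = x1 / x3"
definition u where "u = y2 / y3"
definition v where "v = y1 / y3"

text \<open>Since \<open>u\<^sup>2 (x\<^sub>3\<^sup>2 - 1) = a (a\<^sup>2 x\<^sub>3\<^sup>2 - 1)\<close>, this coordinate makes \<open>u\<^sup>2\<close> and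
  \<open>v\<^sup>2\<close> linear polynomials over \<open>K(a, b)\<close>.\<close>

definition w where "w = x3\<^sup>2 / (1 - x3\<^sup>2)"

lemma x3_neq: "x3 \<noteq> 0" "1 - x3\<^sup>2 \<noteq> 0"
proof -
  note K01 = subfield_0[OF K] subfield_1[OF K]
  have "x3 \<noteq> 0"
    using transcD[OF tower(1), of "[:0, 1:]"] K01 by auto
  moreover have "1 - x3\<^sup>2 \<noteq> 0"
    using transcD[OF tower(1), of "[:1, 0, -1:]"] K01 subfield_uminus[OF K K01(2)]
    by (auto simp: power2_eq_square)
  ultimately show "x3 \<noteq> 0" "1 - x3\<^sup>2 \<noteq> 0" .
qed

lemma y3_neq_0: "y3 \<noteq> 0"
proof
  assume "y3 = 0"
  then have "x3 * (1 - x3\<^sup>2) = 0"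
    using y3 by (simp add: algebra_simps power2_eq_square power3_eq_cube)
  then show False
    using x3_neq by simp
qed

text \<open>Both equations are one formula in \<open>x\<close>: the quotient of cubics is (x/x3) (1
  - x^2)/(1 - x3^2), and its last fraction equals 1 + (1 - (x/x3)^2) w.\<close>

lemma u_square: "u\<^sup>2 = a * (1 + (1 - a\<^sup>2) * w)"
  and v_square: "v\<^sup>2 = b * (1 + (1 - b\<^sup>2) * w)"
proof -
  have *: "(x ^ 3 - x) / (x3 ^ 3 - x3) = x / x3 * (1 + (1 - (x / x3)\<^sup>2) * w)" for x
  proof -
    have "x3 ^ 3 - x3 = - (x3 * (1 - x3\<^sup>2))"
      by (simp add: algebra_simps power2_eq_square power3_eq_cube)
    moreover have "1 + (1 - (x / x3)\<^sup>2) * w = (1 - x\<^sup>2) / (1 - x3\<^sup>2)"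
    proof -
      have "(1 - (x / x3)\<^sup>2) * w = (x3\<^sup>2 - x\<^sup>2) / (1 - x3\<^sup>2)"
        using x3_neq(1) by (simp add: w_def left_diff_distrib power_divide diff_divide_distrib)
      then show ?thesis
        using x3_neq(2) by (simp add: add_divide_eq_iff field_simps)
    qed
    moreover have "x ^ 3 - x = - (x * (1 - x\<^sup>2))"
      by (simp add: algebra_simps power2_eq_square power3_eq_cube)
    ultimately show ?thesis
      by simp
  qed
  show "u\<^sup>2 = a * (1 + (1 - a\<^sup>2) * w)" "v\<^sup>2 = b * (1 + (1 - b\<^sup>2) * w)"
    unfolding u_def v_def a_def b_def power_divide[of y2] power_divide[of y1] y1 y2 y3 by (rule *)+
qed

text \<open>The natural order of adjunction is \<open>w\<close>, \<open>a\<close>, \<open>b\<close>,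
  since \<open>w\<close> depends on \<open>x3\<close> alone. Exchange moves \<open>w\<close> to the
  end, to match the parametrisation, where \<open>W\<close> is constructed over K(A, B).\<close>

lemma transc_abw: "transc K a" "transc (gen_field K {a}) b" "transc (gen_field K {a, b}) w"
proof -
  note K01 = subfield_0[OF K] subfield_1[OF K]
  let ?E = "gen_field K {x3}" and ?G = "gen_field K {x3, x2}"
  note E = is_subfield_gen_field[of K "{x3}"] and G = is_subfield_gen_field[of K "{x3, x2}"]
  have mem: "x3 \<in> ?E" "x3 \<in> ?G" "x2 \<in> ?G"
    by (simp_all add: mem_gen_field)
  have a: "transc ?E a" and b: "transc ?G b"
    unfolding a_def b_def by (intro transc_divide_const is_subfield_gen_field tower mem x3_neq)+
  have "transc K (poly [:0, 0, 1:] x3 / poly [:1, 0, -1:] x3)"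
    by (rule transc_rational[OF is_subfield_imp_is_subring[OF K] tower(1)])
      (use K01 subfield_uminus[OF K K01(2)] in auto)
  then have w: "transc K w"
    by (simp add: w_def power2_eq_square)
  have wE: "w \<in> ?E" and wG: "w \<in> ?G" and aG: "a \<in> ?G"
    unfolding w_def a_def by (intro subfield_intros[OF E] subfield_intros[OF G] mem)+
  show "transc K a"
    by (rule transc_mono[OF a base_subset_gen_field])
  have "gen_field K {w} \<subseteq> ?E"
    by (intro gen_field_least E base_subset_gen_field) (simp add: wE)
  then have aw: "transc (gen_field K {a}) w"
    by (intro transc_exchange[OF K w] transc_mono[OF a])
  have "gen_field K {a, w} \<subseteq> ?G"
    by (intro gen_field_least G base_subset_gen_field) (simp add: wG aG)
  then have "transc (gen_field K {a, w}) b"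
    by (rule transc_mono[OF b])
  then have "transc (gen_field (gen_field K {a}) {w}) b"
    by (simp add: gen_field_gen_field insert_commute)
  from transc_exchange[OF is_subfield_gen_field aw this]
  show "transc (gen_field K {a, b}) w"
    by (simp add: gen_field_gen_field insert_commute)
  have "gen_field K {a} \<subseteq> ?G"
    by (intro gen_field_least G base_subset_gen_field) (simp add: aG)
  then show "transc (gen_field K {a}) b"
    by (rule transc_mono[OF b])
qed

lemma abwuv_in_Z: "a \<in> Z" "b \<in> Z" "w \<in> Z" "u \<in> Z" "v \<in> Z"
  unfolding a_def b_def w_def u_def v_def by (intro subfield_intros[OF Z] mem_Z)+

lemma y_neq_0: "y1 \<noteq> 0" "y2 \<noteq> 0"
proof -
  have *: "y \<noteq> 0" if x: "transc F x" and F: "is_subfield F" and y: "y\<^sup>2 = x ^ 3 - x" for x y F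
  proof
    note F01 = subfield_0[OF F] subfield_1[OF F]
    assume "y = 0"
    then show False
      using transcD[OF x, of "[:0, -1, 0, 1:]"] y F01 subfield_uminus[OF F F01(2)]
      by (simp add: algebra_simps power3_eq_cube)
  qed
  show "y1 \<noteq> 0" "y2 \<noteq> 0"
    using *[OF tower(3) is_subfield_gen_field y1] *[OF tower(2) is_subfield_gen_field y2] .
qed

text \<open>The automorphism negating \<open>y\<^sub>2\<close> alone moves \<open>u\<close> and fixes \<open>a, b, w\<close>; the one negating
  \<open>y\<^sub>1\<close> alone moves \<open>v\<close> and fixes \<open>a, b, w, u\<close>.\<close>

lemma u_notin:
  assumes "(2::'f) \<noteq> 0"
  shows "u \<notin> gen_field K {a, b, w}"
proof
  assume u: "u \<in> gen_field K {a, b, w}"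
  note K1 = subfield_1[OF K]
  obtain \<sigma> where \<sigma>: "K_hom_on K Z \<sigma>" "\<sigma> x1 = x1" "\<sigma> x2 = x2" "\<sigma> x3 = x3" "\<sigma> y2 = - y2" "\<sigma> y3 = y3"
    using curve_action[of 1 "-1" 1] K1 subfield_uminus[OF K K1] by auto
  note hom_simps = hom_diff[OF Z \<sigma>(1)] hom_divide[OF Z \<sigma>(1)] hom_power[OF Z \<sigma>(1)] hom_1[OF Z \<sigma>(1)]
    mem_Z subfield_intros[OF Z] \<sigma>(2-)
  have "\<sigma> u = u"
    by (rule hom_fixes_gen_field[OF Z \<sigma>(1) K_subset_Z _ _ u])
      (use abwuv_in_Z in \<open>auto simp: a_def b_def w_def hom_simps\<close>)
  moreover have "\<sigma> u = - u"
    by (simp add: u_def hom_simps)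
  ultimately have "2 * u = 0"
    by (metis add.right_inverse mult_2)
  then show False
    using assms y_neq_0 y3_neq_0 by (simp add: u_def)
qed

lemma v_notin:
  assumes "(2::'f) \<noteq> 0"
  shows "v \<notin> gen_field K {a, b, w, u}"
proof
  assume v: "v \<in> gen_field K {a, b, w, u}"
  note K1 = subfield_1[OF K]
  obtain \<sigma> where \<sigma>: "K_hom_on K Z \<sigma>" "\<sigma> x1 = x1" "\<sigma> x2 = x2" "\<sigma> x3 = x3" "\<sigma> y1 = - y1"
      "\<sigma> y2 = y2" "\<sigma> y3 = y3"
    using curve_action[of "-1" 1 1] K1 subfield_uminus[OF K K1] by auto
  note hom_simps = hom_diff[OF Z \<sigma>(1)] hom_divide[OF Z \<sigma>(1)] hom_power[OF Z \<sigma>(1)] hom_1[OF Z \<sigma>(1)]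
    mem_Z subfield_intros[OF Z] \<sigma>(2-)
  have "\<sigma> v = v"
    by (rule hom_fixes_gen_field[OF Z \<sigma>(1) K_subset_Z _ _ v])
      (use abwuv_in_Z in \<open>auto simp: a_def b_def w_def u_def hom_simps\<close>)
  moreover have "\<sigma> v = - v"
    by (simp add: v_def hom_simps)
  ultimately have "2 * v = 0"
    by (metis add.right_inverse mult_2)
  then show False
    using assms y_neq_0 y3_neq_0 by (simp add: v_def)
qed

text \<open>\<open>K(Z)\<close> is generated over \<open>L = K(a, b, w, u, v)\<close> by the two square roots \<open>x\<^sub>3\<close> and \<open>y\<^sub>3\<close>, and
  \<open>g\<close> multiplies the four basis elements \<open>1, x\<^sub>3, y\<^sub>3, x\<^sub>3 y\<^sub>3\<close> by \<open>1, -1, i, -i\<close>.\<close>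

lemma fun_field_X_subset:
  assumes two: "(2::'f) \<noteq> 0" and ii: "ii \<in> K" "ii\<^sup>2 = -1"
  shows "fun_field_X K ii x1 y1 x2 y2 x3 y3 \<subseteq> gen_field K {a, b, w, u, v}"
proof
  fix f assume f: "f \<in> fun_field_X K ii x1 y1 x2 y2 x3 y3"
  let ?L = "gen_field K {a, b, w, u, v}"
  note L = is_subfield_gen_field[of K "{a, b, w, u, v}"]
  have KL: "K \<subseteq> ?L" and mem_L: "a \<in> ?L" "b \<in> ?L" "w \<in> ?L" "u \<in> ?L" "v \<in> ?L"
    by (rule base_subset_gen_field) (simp_all add: mem_gen_field)
  have "?L \<subseteq> Z"
    using abwuv_in_Z by (intro gen_field_least Z K_subset_Z) auto
  have ii4: "ii ^ 4 = 1"
    using ii(2) by (metis mult_2_right numeral_Bit0 power_add minus_one_mult_self mult_minus1 power2_eq_square square_eq_1_iff)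
  \<comment> \<open>Membership in \<open>fun_field_X\<close> quantifies over all homomorphisms
    acting like \<open>g\<close>; it constrains \<open>f\<close> only once such a homomorphism has
    been constructed.\<close>
  obtain \<sigma> where \<sigma>: "K_hom_on K Z \<sigma>"
    "\<sigma> x1 = - x1" "\<sigma> y1 = ii * y1" "\<sigma> x2 = - x2" "\<sigma> y2 = ii * y2" "\<sigma> x3 = - x3" "\<sigma> y3 = ii * y3"
    using curve_action[OF ii(1) ii4 ii(1) ii4 ii(1) ii4] ii(2) by auto
  note hom_simps = hom_diff[OF Z \<sigma>(1)] hom_divide[OF Z \<sigma>(1)] hom_power[OF Z \<sigma>(1)] hom_1[OF Z \<sigma>(1)]
    mem_Z subfield_intros[OF Z] \<sigma>(2-)
  have ii0: "ii \<noteq> 0"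
    using ii4 by auto
  have \<sigma>L: "\<sigma> z = z" if "z \<in> ?L" for z
    by (rule hom_fixes_gen_field[OF Z \<sigma>(1) K_subset_Z _ _ that])
      (use abwuv_in_Z ii0 in \<open>auto simp: a_def b_def w_def u_def v_def hom_simps\<close>)
  let ?L' = "gen_field ?L {x3}"
  note L' = is_subfield_gen_field[of ?L "{x3}"]
  have x3L': "x3 \<in> ?L'" and LL': "?L \<subseteq> ?L'"
    by (simp_all add: mem_gen_field base_subset_gen_field)
  \<comment> \<open>Inverts the definition of \<open>w\<close>, so that \<open>x3\<close> is a
    square root over \<open>?L\<close>.\<close>
  have "x3\<^sup>2 = w / (1 + w)"
    using x3_neq by (simp add: w_def field_simps)
  then have x3sq: "x3\<^sup>2 \<in> ?L"
    by (simp add: mem_L subfield_intros[OF L])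
  have y3sq: "y3\<^sup>2 \<in> ?L'"
    unfolding y3 by (intro subfield_intros[OF L'] x3L')
  let ?M = "gen_field ?L' {y3}"
  note M = is_subfield_gen_field[of ?L' "{y3}"]
  have y3M: "y3 \<in> ?M" and L'M: "?L' \<subseteq> ?M"
    by (simp_all add: mem_gen_field base_subset_gen_field)
  have LM: "?L \<subseteq> ?M"
    using LL' L'M by (rule order.trans)
  have x3M: "x3 \<in> ?M"
    using x3L' L'M by blast
  have "x1 = b * x3" "x2 = a * x3" "y1 = v * y3" "y2 = u * y3"
    using x3_neq y3_neq_0 by (simp_all add: a_def b_def u_def v_def)
  moreover have "b * x3 \<in> ?M" "a * x3 \<in> ?M" "v * y3 \<in> ?M" "u * y3 \<in> ?M"
    using mem_L LM x3M y3M by (auto intro!: subfield_mult[OF M])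
  ultimately have "{x1, y1, x2, y2, x3, y3} \<subseteq> ?M"
    using x3M y3M by simp
  then have "Z \<subseteq> ?M"
    using KL LM by (intro gen_field_least M) auto
  then have "f \<in> ?M"
    using f by (auto simp: fun_field_X_def fun_field_Z_def)
  then obtain \<alpha> \<beta> where \<alpha>\<beta>: "\<alpha> \<in> ?L'" "\<beta> \<in> ?L'" "f = \<alpha> + \<beta> * y3"
    using gen_field_sqrtE[OF L' y3sq] by metis
  obtain p q where pq: "p \<in> ?L" "q \<in> ?L" "\<alpha> = p + q * x3"
    using gen_field_sqrtE[OF L x3sq \<alpha>\<beta>(1)] by metis
  obtain r s where rs: "r \<in> ?L" "s \<in> ?L" "\<beta> = r + s * x3"
    using gen_field_sqrtE[OF L x3sq \<alpha>\<beta>(2)] by metis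
  have mem: "p \<in> Z" "q \<in> Z" "r \<in> Z" "s \<in> Z" "ii \<in> Z"
    using pq rs ii(1) \<open>?L \<subseteq> Z\<close> K_subset_Z by auto
  note hom_simps' = hom_add[OF Z \<sigma>(1)] hom_mult[OF Z \<sigma>(1)] hom_uminus[OF Z \<sigma>(1)] hom_simps mem
    \<sigma>L[OF pq(1)] \<sigma>L[OF pq(2)] \<sigma>L[OF rs(1)] \<sigma>L[OF rs(2)]
  have fixed: "\<sigma> f = f"
    using f \<sigma> by (auto simp: fun_field_X_def fun_field_Z_def)
  have f_eq: "f = p + q * x3 + (r + s * x3) * y3"
    by (simp add: \<alpha>\<beta> pq rs)
  have \<sigma>f: "\<sigma> f = p - q * x3 + ii * (r - s * x3) * y3"
    unfolding f_eq by (simp add: hom_simps' algebra_simps)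
  \<comment> \<open>The square of \<open>\<sigma>\<close> fixes \<open>x3\<close> and negates
    \<open>y3\<close>, which removes the \<open>y3\<close> part of \<open>f\<close>; a single
    application then removes the \<open>x3\<close> part.\<close>
  have "\<sigma> (\<sigma> f) = p + q * x3 + ii\<^sup>2 * ((r + s * x3) * y3)"
    unfolding \<sigma>f
    by (simp add: hom_simps' hom_base[OF Z \<sigma>(1) ii(1)] algebra_simps power2_eq_square)
  then have "2 * ((r + s * x3) * y3) = 0"
    using fixed f_eq ii(2) by (simp add: algebra_simps)
  then have f_eq': "f = p + q * x3"
    using two f_eq by simp
  have "\<sigma> f = p - q * x3"
    unfolding f_eq' by (simp add: hom_simps')
  then have "2 * (q * x3) = 0"
    using fixed f_eq' by (simp add: algebra_simps)
  then show "f \<in> ?L"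
    using two x3_neq f_eq' pq by simp
qed

end

section \<open>The base change\<close>

text \<open>The conic \<open>(1 - B\<^sup>2) (p\<^sup>2 - 1) = (1 - A\<^sup>2) (q\<^sup>2 - 1)\<close>, where
  \<open>p\<^sup>2 = 1 + (1 - A\<^sup>2) w\<close> and \<open>q\<^sup>2 = 1 + (1 - B\<^sup>2) w\<close>, has the point \<open>(1, 1)\<close>, where \<open>w = 0\<close>; the lines
  \<open>q - 1 = t\<^sub>1 (p - 1)\<close> through it parametrise the conic. Taking \<open>A\<close> and \<open>B\<close> to be squares makes \<open>A p\<^sup>2\<close> and
  \<open>B q\<^sup>2\<close> squares as well.\<close>

lemma rational_parametrisation:
  fixes K :: "'f::field set"
  assumes K: "is_subfield K" and two: "(2::'f) \<noteq> 0" and indep: "alg_indep3 K t1 t2 t3"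
  obtains A B W U V where "{A, B, W, U, V} \<subseteq> gen_field K {t1, t2, t3}"
    "transc K A" "transc (gen_field K {A}) B" "transc (gen_field K {A, B}) W"
    "U\<^sup>2 = A * (1 + (1 - A\<^sup>2) * W)" "V\<^sup>2 = B * (1 + (1 - B\<^sup>2) * W)"
proof -
  note tower = alg_indep3_tower[OF K indep]
  have square: "transc F (x\<^sup>2)" "1 - (x\<^sup>2)\<^sup>2 \<noteq> 0" if F: "is_subfield F" and x: "transc F x" for F and x :: 'f
  proof -
    note F01 = subfield_0[OF F] subfield_1[OF F]
    have "transc F (poly [:0, 0, 1:] x / poly [:1:] x)"
      by (rule transc_rational[OF is_subfield_imp_is_subring[OF F] x]) (use F01 in auto)
    then show "transc F (x\<^sup>2)"
      by (simp add: power2_eq_square)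
    show "1 - (x\<^sup>2)\<^sup>2 \<noteq> 0"
      using transcD[OF x, of "[:1, 0, 0, 0, -1:]"] F01 subfield_uminus[OF F F01(2)]
      by (auto simp: power2_eq_square algebra_simps)
  qed
  define A B where "A = t3\<^sup>2" and "B = t2\<^sup>2"
  define c d where "c = 1 - A\<^sup>2" and "d = 1 - B\<^sup>2"
  let ?M = "gen_field K {t3, t2}" and ?T = "gen_field K {t1, t2, t3}"
  note M = is_subfield_gen_field[of K "{t3, t2}"] and T = is_subfield_gen_field[of K "{t1, t2, t3}"]
  have A: "transc K A" and B: "transc (gen_field K {t3}) B" and c: "c \<noteq> 0" and d: "d \<noteq> 0"
    using square[OF K tower(1)] square[OF is_subfield_gen_field tower(2)]
    by (simp_all add: A_def B_def c_def d_def)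
  have t3K: "t3 \<in> gen_field K {t3}" and tM: "t3 \<in> ?M" "t2 \<in> ?M"
    and tT: "t1 \<in> ?T" "t2 \<in> ?T" "t3 \<in> ?T"
    by (simp_all add: mem_gen_field)
  have "gen_field K {A} \<subseteq> gen_field K {t3}"
    by (intro gen_field_least is_subfield_gen_field base_subset_gen_field)
      (simp add: A_def subfield_power[OF is_subfield_gen_field] t3K)
  then have B': "transc (gen_field K {A}) B"
    by (rule transc_mono[OF B])
  have AM: "A \<in> ?M" and BM: "B \<in> ?M"
    unfolding A_def B_def by (intro subfield_power[OF M] tM)+
  then have cM: "c \<in> ?M" and dM: "d \<in> ?M"
    unfolding c_def d_def by (simp_all add: subfield_intros[OF M])
  note Mr = is_subfield_imp_is_subring[OF M]
  \<comment> \<open>Putting q = 1 + t1 (p - 1) into d (p^2 - 1) = c (q^2 - 1) and dividing by p - 1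
    gives p - 1 = 2 (c t1 - d)/D; then W = (p^2 - 1)/c.\<close>
  define D where "D = d - c * t1\<^sup>2"
  define W where "W = 4 * t1 * (1 - t1) * (c * t1 - d) / D\<^sup>2"
  let ?n = "[:0, 4:] * ([:1, -1:] * [:- d, c:])" and ?d = "[:d, 0, - c:]"
  have four: "(4::'f) \<noteq> 0"
    using two by (metis mult_2_right mult_eq_0_iff numeral_Bit0 numeral_plus_numeral)
  have coeffs: "coeffs_in ?M [:0, 4:]" "coeffs_in ?M [:1, -1:]" "coeffs_in ?M [:- d, c:]" "coeffs_in ?M ?d"
    by (simp_all add: subfield_intros[OF M] cM dM)
  \<comment> \<open>The numerator vanishes at t1 = 0 and the denominator takes the nonzero value d^2
    there, as \<open>transc_rational\<close> requires.\<close>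
  have "transc ?M (poly ?n t1 / poly (?d\<^sup>2) t1)"
  proof (rule transc_rational[OF Mr tower(3)])
    show "?n \<noteq> 0"
      unfolding mult_eq_0_iff using c four by simp
  qed (use d in \<open>intro coeffs_in_mult coeffs_in_power Mr coeffs | simp\<close>)+
  then have "transc ?M W"
    by (simp add: W_def D_def power2_eq_square algebra_simps)
  moreover have "gen_field K {A, B} \<subseteq> ?M"
    by (intro gen_field_least M base_subset_gen_field) (simp add: AM BM)
  ultimately have W: "transc (gen_field K {A, B}) W"
    by (rule transc_mono)
  have D: "D \<noteq> 0"
  proof
    assume "D = 0"
    then have "?d = 0"
      by (intro transcD[OF tower(3) coeffs(4)]) (simp add: D_def power2_eq_square algebra_simps)
    then show False using d by simp
  qed
  \<comment> \<open>The second point in which the line of slope \<open>t1\<close> through (1, 1)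
    meets the conic.\<close>
  define p q where "p = (2 * c * t1 - c * t1\<^sup>2 - d) / D" and "q = (d + c * t1\<^sup>2 - 2 * d * t1) / D"
  have p: "p\<^sup>2 = 1 + c * W" and q: "q\<^sup>2 = 1 + d * W"
  proof -
    have "(2 * c * t1 - c * t1\<^sup>2 - d)\<^sup>2 = D\<^sup>2 + c * (4 * t1 * (1 - t1) * (c * t1 - d))"
      "(d + c * t1\<^sup>2 - 2 * d * t1)\<^sup>2 = D\<^sup>2 + d * (4 * t1 * (1 - t1) * (c * t1 - d))"
      unfolding D_def by algebra+
    then show "p\<^sup>2 = 1 + c * W" "q\<^sup>2 = 1 + d * W"
      using D by (simp_all add: p_def q_def W_def power_divide add_divide_distrib)
  qed
  show ?thesis
  proof (rule that[OF _ A B' W])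
    show "(t3 * p)\<^sup>2 = A * (1 + (1 - A\<^sup>2) * W)" "(t2 * q)\<^sup>2 = B * (1 + (1 - B\<^sup>2) * W)"
      using p q by (simp_all add: power_mult_distrib A_def B_def c_def d_def)
    show "{A, B, W, t3 * p, t2 * q} \<subseteq> ?T"
      unfolding W_def p_def q_def D_def c_def d_def A_def B_def
      by (simp add: subfield_intros[OF T] tT)
  qed
qed

text \<open>A dominant rational map from projective 3-space to \<open>X\<close> amounts to an
  embedding over \<open>K\<close> of k(X) into the rational function field
  \<open>gen_field K {t1, t2, t3}\<close>. The embedding is built on
  \<open>gen_field K {a, b, w, u, v}\<close>, one generator at a time, and then restricted;
  injectivity is automatic for fields.\<close>

theorem theorem1:
  fixes K :: "'f::field set"
    and ii x1 y1 x2 y2 x3 y3 t1 t2 t3 :: 'f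
  assumes "is_subfield K"
    and "(2::'f) \<noteq> 0"
    and "ii \<in> K" and "ii ^ 2 = -1"
    and "alg_indep3 K x1 x2 x3"
    and "y1 ^ 2 = x1 ^ 3 - x1" and "y2 ^ 2 = x2 ^ 3 - x2" and "y3 ^ 2 = x3 ^ 3 - x3"
    and "alg_indep3 K t1 t2 t3"
  shows "\<exists>\<phi>. K_hom_on K (fun_field_X K ii x1 y1 x2 y2 x3 y3) \<phi> \<and>
              inj_on \<phi> (fun_field_X K ii x1 y1 x2 y2 x3 y3) \<and>
              \<phi> ` fun_field_X K ii x1 y1 x2 y2 x3 y3 \<subseteq> gen_field K {t1, t2, t3}"
proof -
  interpret curve_triple K x1 y1 x2 y2 x3 y3
    by unfold_locales fact+
  let ?X = "fun_field_X K ii x1 y1 x2 y2 x3 y3" and ?T = "gen_field K {t1, t2, t3}"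
  note K = assms(1) and two = assms(2)
  note K1 = subfield_1[OF K]
  note E = is_subfield_gen_field and KE = base_subset_gen_field[of K]
  obtain A B W U V where T: "{A, B, W, U, V} \<subseteq> ?T"
    and A: "transc K A" and B: "transc (gen_field K {A}) B" and W: "transc (gen_field K {A, B}) W"
    and U: "U\<^sup>2 = A * (1 + (1 - A\<^sup>2) * W)" and V: "V\<^sup>2 = B * (1 + (1 - B\<^sup>2) * W)"
    using rational_parametrisation[OF K two assms(9)] by metis
  have K_im: "\<psi> ` K \<subseteq> G" if "K_hom_on K F \<psi>" "K \<subseteq> G" for F G \<psi>
    using that unfolding K_hom_on_def by auto
  have id: "K_hom_on K K (\<lambda>z. z)"
    by (simp add: K_hom_on_def)
  obtain \<phi>1 where \<phi>1: "K_hom_on K (gen_field K {a}) \<phi>1" "\<phi>1 a = A"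
    using extend_hom_transc[OF K id _ K1 transc_abw(1) A] by auto
  \<comment> \<open>The image has to be located in K(A), because that is the field over which
    \<open>B\<close> is known to be transcendental.\<close>
  have "\<phi>1 ` gen_field K {a} \<subseteq> gen_field K {A}"
    by (intro hom_image_gen_field[OF \<phi>1(1) E] K_im[OF \<phi>1(1)] KE) (simp add: \<phi>1 mem_gen_field)
  then obtain \<phi>2 where \<phi>2: "K_hom_on K (gen_field K {a, b}) \<phi>2" "\<phi>2 a = A" "\<phi>2 b = B"
    using extend_hom_transc[OF E \<phi>1(1) KE K1 transc_abw(2) B] \<phi>1(2) mem_gen_field[of a "{a}"]
    by (metis gen_field_gen_field Un_insert_left Un_empty_left singletonI)
  have "\<phi>2 ` gen_field K {a, b} \<subseteq> gen_field K {A, B}"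
    by (intro hom_image_gen_field[OF \<phi>2(1) E] K_im[OF \<phi>2(1)] KE) (simp add: \<phi>2 mem_gen_field)
  then obtain \<phi>3 where "K_hom_on K (gen_field (gen_field K {a, b}) {w}) \<phi>3" "\<phi>3 w = W"
      "\<And>z. z \<in> gen_field K {a, b} \<Longrightarrow> \<phi>3 z = \<phi>2 z"
    using extend_hom_transc[OF E \<phi>2(1) KE K1 transc_abw(3) W] by metis
  then have \<phi>3: "K_hom_on K (gen_field K {a, b, w}) \<phi>3" "\<phi>3 a = A" "\<phi>3 b = B" "\<phi>3 w = W"
    using \<phi>2 by (simp_all add: gen_field_gen_field insert_commute mem_gen_field)
  let ?L0 = "gen_field K {a, b, w}"
  have abw: "a \<in> ?L0" "b \<in> ?L0" "w \<in> ?L0"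
    by (simp_all add: mem_gen_field)
  note L0_intros = subfield_intros[OF E[of K "{a, b, w}"]]
  note hom_simps = hom_add[OF E \<phi>3(1)] hom_mult[OF E \<phi>3(1)] hom_diff[OF E \<phi>3(1)]
    hom_power[OF E \<phi>3(1)] hom_1[OF E \<phi>3(1)] abw L0_intros \<phi>3(2-)
  have u2: "u\<^sup>2 \<in> ?L0" and v2: "v\<^sup>2 \<in> ?L0"
    unfolding u_square v_square by (intro L0_intros abw)+
  \<comment> \<open>The squares of \<open>u\<close>, \<open>v\<close> and of \<open>U\<close>,
    \<open>V\<close> are given by the same formulas in corresponding coordinates, so
    \<open>u\<close> and \<open>v\<close> may be sent to \<open>U\<close> and \<open>V\<close>;
    \<open>u_notin\<close> and \<open>v_notin\<close> make both adjunctions genuinely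
    quadratic.\<close>
  have "U\<^sup>2 = \<phi>3 (u\<^sup>2)" and V': "V\<^sup>2 = \<phi>3 (v\<^sup>2)"
    unfolding U V u_square v_square by (simp_all add: hom_simps)
  then obtain \<phi>4 where "K_hom_on K (gen_field ?L0 {u}) \<phi>4" "\<phi>4 u = U"
      and \<phi>43: "\<And>z. z \<in> ?L0 \<Longrightarrow> \<phi>4 z = \<phi>3 z"
    using extend_hom_sqrt[OF E \<phi>3(1) KE K1 u2 u_notin[OF two]] by metis
  then have \<phi>4: "K_hom_on K (gen_field K {a, b, w, u}) \<phi>4" "\<phi>4 u = U"
      "\<phi>4 a = A" "\<phi>4 b = B" "\<phi>4 w = W"
    using \<phi>3 abw by (simp_all add: gen_field_gen_field insert_commute)
  let ?L1 = "gen_field K {a, b, w, u}"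
  have "?L0 \<subseteq> ?L1"
    by (rule gen_field_mono) auto
  then have v2': "v\<^sup>2 \<in> ?L1"
    using v2 by blast
  have "V\<^sup>2 = \<phi>4 (v\<^sup>2)"
    using V' \<phi>43[OF v2] by simp
  then obtain \<phi> where "K_hom_on K (gen_field ?L1 {v}) \<phi>" "\<phi> v = V"
      "\<And>z. z \<in> ?L1 \<Longrightarrow> \<phi> z = \<phi>4 z"
    using extend_hom_sqrt[OF E \<phi>4(1) KE K1 v2' v_notin[OF two]] by metis
  then have \<phi>: "K_hom_on K (gen_field K {a, b, w, u, v}) \<phi>"
      "\<phi> v = V" "\<phi> u = U" "\<phi> a = A" "\<phi> b = B" "\<phi> w = W"
    using \<phi>4 by (simp_all add: gen_field_gen_field insert_commute mem_gen_field)
  let ?L = "gen_field K {a, b, w, u, v}"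
  have X: "?X \<subseteq> ?L"
    by (rule fun_field_X_subset[OF two assms(3,4)])
  have "\<phi> ` ?L \<subseteq> ?T"
    using T by (intro hom_image_gen_field[OF \<phi>(1) E] K_im[OF \<phi>(1)] KE) (simp add: \<phi>)
  then show ?thesis
    using X K_hom_on_mono[OF \<phi>(1) X] inj_on_subset[OF hom_inj_on[OF E \<phi>(1)] X] by blast
qed

end
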